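(* Let $X$ be a nonempty set and let $\mathrm{Perm}\mathrm{Der}\langle X,d\rangle$ be the free differential Perm-algebra generated by $X$ over a field $\Bbbk$. Let $F$ be the subalgebra generated by $X$ in $\mathrm{Perm}\mathrm{Der}\langle X,d\rangle$ relative to the operation $f\circ g=f\,d(g)$, $f,g\in\mathrm{Perm}\mathrm{Der}\langle X,d\rangle$. Then $F$ is isomorphic to the free SLS-algebra generated by $X$.
   Context: $\Bbbk$ is an arbitrary field. A Perm-algebra is an associative (not necessarily unital) algebra satisfying $xyz=yxz$. A differential Perm-algebra is a pair $(P,d)$ with $P$ a Perm-algebra and $d$ a derivation of $P$; $\mathrm{Perm}\mathrm{Der}\langle X,d\rangle$ denotes the free such object on $X$. As a Perm-algebra it is the free Perm-algebra on $X^{(\omega)}=X\cup X'\cup X''\cup\dots$, where $X^{(n)}=\{x^{(n)}\mid x\in X\}$, $n\ge0$, are disjoint copies of $X$, and $d(x^{(n)})=x^{(n+1)}$. An SLS-algebra is a linear space over $\Bbbk$ with a bilinear operation $\circ$ satisfying, with $(a,b,c)=(a\circ b)\circ c-a\circ(b\circ c)$, the identities $(x,y,z)=(y,x,z)$ (left symmetry), $\;((x\circ y)\circ z)\circ u=((x\circ z)\circ y)\circ u$, $\;(x,y\circ z,u)=(y,x\circ z,u)$. The free SLS-algebra generated by $X$ is the free algebra on $X$ in this variety. *)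

theory Defs
  imports Complex_Main "HOL-Library.Poly_Mapping"
begin

section \<open>Algebras over a field\<close>

text \<open>
  An algebra is a vector space \<^term>\<open>scale\<close> together with a bilinear operation; neither
  associativity nor a unit is assumed.
\<close>

locale nonassoc_algebra = vector_space scale
  for scale :: "'k::field \<Rightarrow> 'a::ab_group_add \<Rightarrow> 'a" +
  fixes mul :: "'a \<Rightarrow> 'a \<Rightarrow> 'a"
  assumes linear_mul_right: "Vector_Spaces.linear scale scale (\<lambda>y. mul x y)"
    and linear_mul_left: "Vector_Spaces.linear scale scale (\<lambda>x. mul x y)"

locale perm_algebra = nonassoc_algebra +
  assumes mul_assoc: "mul (mul x y) z = mul x (mul y z)"
    and perm: "mul (mul x y) z = mul (mul y x) z"

locale diff_perm_algebra = perm_algebra +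
  fixes d :: "'b \<Rightarrow> 'b"
  assumes linear_d: "Vector_Spaces.linear scale scale d"
    and leibniz: "d (mul x y) = mul (d x) y + mul x (d y)"

definition associator :: "('a::ab_group_add \<Rightarrow> 'a \<Rightarrow> 'a) \<Rightarrow> 'a \<Rightarrow> 'a \<Rightarrow> 'a \<Rightarrow> 'a" where
  "associator mul x y z = mul (mul x y) z - mul x (mul y z)"

locale sls_algebra = nonassoc_algebra +
  assumes left_symmetric: "associator mul x y z = associator mul y x z"
    and right_commutative: "mul (mul (mul x y) z) u = mul (mul (mul x z) y) u"
    and associator_exchange: "associator mul x (mul y z) u = associator mul y (mul x z) u"

definition algebra_hom ::
  "('k::field \<Rightarrow> 'a::ab_group_add \<Rightarrow> 'a) \<Rightarrow> ('a \<Rightarrow> 'a \<Rightarrow> 'a) \<Rightarrow>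
   ('k \<Rightarrow> 'b::ab_group_add \<Rightarrow> 'b) \<Rightarrow> ('b \<Rightarrow> 'b \<Rightarrow> 'b) \<Rightarrow> ('a \<Rightarrow> 'b) \<Rightarrow> bool" where
  "algebra_hom s1 m1 s2 m2 \<phi> \<longleftrightarrow>
     Vector_Spaces.linear s1 s2 \<phi> \<and> (\<forall>x y. \<phi> (m1 x y) = m2 (\<phi> x) (\<phi> y))"

definition subalgebra ::
  "('k::field \<Rightarrow> 'a::ab_group_add \<Rightarrow> 'a) \<Rightarrow> ('a \<Rightarrow> 'a \<Rightarrow> 'a) \<Rightarrow> 'a set \<Rightarrow> bool" where
  "subalgebra scale mul S \<longleftrightarrow>
     module.subspace scale S \<and> (\<forall>x\<in>S. \<forall>y\<in>S. mul x y \<in> S)"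

definition generated_subalgebra ::
  "('k::field \<Rightarrow> 'a::ab_group_add \<Rightarrow> 'a) \<Rightarrow> ('a \<Rightarrow> 'a \<Rightarrow> 'a) \<Rightarrow> 'a set \<Rightarrow> 'a set" where
  "generated_subalgebra scale mul G = subalgebra scale mul hull G"

text \<open>
  Isomorphism of two algebras given by carriers \<^term>\<open>A\<close> and \<^term>\<open>B\<close>, which are meant to be
  closed under the respective operations.
\<close>

definition algebra_isomorphic ::
  "('k::field \<Rightarrow> 'a::ab_group_add \<Rightarrow> 'a) \<Rightarrow> ('a \<Rightarrow> 'a \<Rightarrow> 'a) \<Rightarrow> 'a set \<Rightarrow>
   ('k \<Rightarrow> 'b::ab_group_add \<Rightarrow> 'b) \<Rightarrow> ('b \<Rightarrow> 'b \<Rightarrow> 'b) \<Rightarrow> 'b set \<Rightarrow> bool" where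
  "algebra_isomorphic s1 m1 A s2 m2 B \<longleftrightarrow>
     (\<exists>\<phi>. bij_betw \<phi> A B \<and>
          (\<forall>x\<in>A. \<forall>y\<in>A. \<phi> (x + y) = \<phi> x + \<phi> y) \<and>
          (\<forall>c. \<forall>x\<in>A. \<phi> (s1 c x) = s2 c (\<phi> x)) \<and>
          (\<forall>x\<in>A. \<forall>y\<in>A. \<phi> (m1 x y) = m2 (\<phi> x) (\<phi> y)))"


section \<open>Free vector spaces\<close>

text \<open>
  \<^typ>\<open>'b \<Rightarrow>\<^sub>0 'k\<close> is the vector space with basis the type \<^typ>\<open>'b\<close>, the basis vectors being
  the elements \<^term>\<open>Poly_Mapping.single u 1\<close>.
\<close>

definition fscale :: "'k::field \<Rightarrow> ('b \<Rightarrow>\<^sub>0 'k) \<Rightarrow> ('b \<Rightarrow>\<^sub>0 'k)" where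
  "fscale c p = Poly_Mapping.map (\<lambda>a. c * a) p"

definition lin_ext ::
  "('k::field \<Rightarrow> 'a::ab_group_add \<Rightarrow> 'a) \<Rightarrow> ('b \<Rightarrow> 'a) \<Rightarrow> ('b \<Rightarrow>\<^sub>0 'k) \<Rightarrow> 'a" where
  "lin_ext scale g p = (\<Sum>u\<in>Poly_Mapping.keys p. scale (Poly_Mapping.lookup p u) (g u))"

lemma lookup_fscale [simp]:
  "Poly_Mapping.lookup (fscale c p) u = c * Poly_Mapping.lookup p u"
  by (simp add: fscale_def Poly_Mapping.map.rep_eq when_def)

lemma vector_space_fscale: "vector_space (fscale :: 'k::field \<Rightarrow> ('b \<Rightarrow>\<^sub>0 'k) \<Rightarrow> _)"
  by unfold_locales (auto intro!: poly_mapping_eqI simp: lookup_add algebra_simps)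

lemma vs_linearI:
  assumes "vector_space s1" "vector_space s2"
    and "\<And>x y. f (x + y) = f x + f y" "\<And>c x. f (s1 c x) = s2 c (f x)"
  shows "Vector_Spaces.linear s1 s2 f"
proof -
  interpret a: vector_space s1 by fact
  interpret b: vector_space s2 by fact
  show ?thesis by unfold_locales (fact assms)+
qed

lemma lin_ext_superset:
  assumes "vector_space scale" "finite A" "Poly_Mapping.keys p \<subseteq> A"
  shows "lin_ext scale g p = (\<Sum>u\<in>A. scale (Poly_Mapping.lookup p u) (g u))"
proof -
  interpret vector_space scale by fact
  show ?thesis unfolding lin_ext_def
    using assms by (intro sum.mono_neutral_left) (auto simp: in_keys_iff)
qed

lemma linear_lin_ext:
  fixes scale :: "'k::field \<Rightarrow> 'a::ab_group_add \<Rightarrow> 'a" and g :: "'b \<Rightarrow> 'a"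
  assumes "vector_space scale"
  shows "Vector_Spaces.linear fscale scale (lin_ext scale g)"
proof -
  interpret vector_space scale by fact
  interpret f: vector_space "fscale :: 'k \<Rightarrow> ('b \<Rightarrow>\<^sub>0 'k) \<Rightarrow> _" by (rule vector_space_fscale)
  show ?thesis
  proof (rule vs_linearI[OF vector_space_fscale assms])
    fix p q :: "'b \<Rightarrow>\<^sub>0 'k"
    let ?A = "Poly_Mapping.keys p \<union> Poly_Mapping.keys q"
    show "lin_ext scale g (p + q) = lin_ext scale g p + lin_ext scale g q"
      using keys_add[of p q]
      by (simp add: lin_ext_superset[OF assms, of ?A] lookup_add scale_left_distrib sum.distrib)
  next
    fix c and p :: "'b \<Rightarrow>\<^sub>0 'k"
    have "Poly_Mapping.keys (fscale c p) \<subseteq> Poly_Mapping.keys p"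
      by (auto simp: in_keys_iff)
    then show "lin_ext scale g (fscale c p) = scale c (lin_ext scale g p)"
      by (simp add: lin_ext_superset[OF assms, of "Poly_Mapping.keys p"] scale_sum_right)
  qed
qed

lemma lin_ext_single [simp]:
  assumes "vector_space scale"
  shows "lin_ext scale g (Poly_Mapping.single u 1) = g u"
proof -
  interpret vector_space scale by fact
  show ?thesis by (simp add: lin_ext_def)
qed

lemma linear_lin_ext_comp:
  assumes "Vector_Spaces.linear s1 s2 \<phi>"
  shows "\<phi> (lin_ext s1 g p) = lin_ext s2 (\<lambda>u. \<phi> (g u)) p"
proof -
  interpret Vector_Spaces.linear s1 s2 \<phi> by fact
  show ?thesis by (simp add: lin_ext_def sum scale)
qed

lemma lin_ext_singles [simp]: "lin_ext fscale (\<lambda>u. Poly_Mapping.single u 1) p = p"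
proof (rule poly_mapping_eqI)
  fix v
  show "Poly_Mapping.lookup (lin_ext fscale (\<lambda>u. Poly_Mapping.single u 1) p) v
      = Poly_Mapping.lookup p v"
    by (cases "v \<in> Poly_Mapping.keys p")
       (simp_all add: lin_ext_def lookup_sum lookup_single when_def if_distrib
          in_keys_iff cong: if_cong)
qed

lemma linear_lin_ext_pointwise:
  assumes "vector_space s1" "\<And>u. Vector_Spaces.linear s1 s2 (g u)" "vector_space s2"
  shows "Vector_Spaces.linear s1 s2 (\<lambda>q. lin_ext s2 (\<lambda>u. g u q) p)"
proof -
  interpret s1: vector_space s1 by fact
  interpret s2: vector_space s2 by fact
  interpret g: Vector_Spaces.linear s1 s2 "g u" for u by fact
  show ?thesis
    by (rule vs_linearI[OF assms(1,3)])
       (simp_all add: lin_ext_def g.add g.scale s2.scale_right_distrib sum.distrib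
          s2.scale_sum_right mult.commute)
qed


section \<open>The free SLS-algebra\<close>

datatype 'x word = Letter 'x | Prod "'x word" "'x word"

text \<open>The free nonassociative algebra, with basis the nonassociative words.\<close>

definition word_mul :: "('x word \<Rightarrow>\<^sub>0 'k::field) \<Rightarrow> ('x word \<Rightarrow>\<^sub>0 'k) \<Rightarrow> ('x word \<Rightarrow>\<^sub>0 'k)" where
  "word_mul p q =
     lin_ext fscale (\<lambda>u. lin_ext fscale (\<lambda>v. Poly_Mapping.single (Prod u v) 1) q) p"

text \<open>The two-sided ideal generated by all instances of the defining identities.\<close>

inductive_set sls_ideal :: "('x word \<Rightarrow>\<^sub>0 'k::field) set" where
  zero: "0 \<in> sls_ideal"
| add: "p \<in> sls_ideal \<Longrightarrow> q \<in> sls_ideal \<Longrightarrow> p + q \<in> sls_ideal"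
| scale: "p \<in> sls_ideal \<Longrightarrow> fscale c p \<in> sls_ideal"
| mul_left: "p \<in> sls_ideal \<Longrightarrow> word_mul q p \<in> sls_ideal"
| mul_right: "p \<in> sls_ideal \<Longrightarrow> word_mul p q \<in> sls_ideal"
| left_symmetric: "associator word_mul x y z - associator word_mul y x z \<in> sls_ideal"
| right_commutative:
    "word_mul (word_mul (word_mul x y) z) u - word_mul (word_mul (word_mul x z) y) u \<in> sls_ideal"
| associator_exchange:
    "associator word_mul x (word_mul y z) u - associator word_mul y (word_mul x z) u \<in> sls_ideal"

interpretation word: nonassoc_algebra fscale word_mul
proof -
  show "nonassoc_algebra fscale (word_mul :: ('x word \<Rightarrow>\<^sub>0 'k::field) \<Rightarrow> _)"
    unfolding word_mul_def
    by (intro nonassoc_algebra.intro nonassoc_algebra_axioms.intro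
        linear_lin_ext linear_lin_ext_pointwise vector_space_fscale)
qed

context nonassoc_algebra begin

sublocale mr: Vector_Spaces.linear scale scale "\<lambda>y. mul x y" for x by (rule linear_mul_right)
sublocale ml: Vector_Spaces.linear scale scale "\<lambda>x. mul x y" for y by (rule linear_mul_left)

lemma mul_diff_swap: "mul a b - mul a' b' = mul (a - a') b + mul a' (b - b')"
  using ml.diff[of a a' b] mr.diff[of a' b b'] by simp

end

lemma sls_ideal_uminus: "p \<in> sls_ideal \<Longrightarrow> - p \<in> sls_ideal"
  using sls_ideal.scale[of p "- 1"] by simp

lemma sls_ideal_diff: "p \<in> sls_ideal \<Longrightarrow> q \<in> sls_ideal \<Longrightarrow> p - q \<in> sls_ideal"
  using sls_ideal.add[of p "- q"] sls_ideal_uminus[of q] by simp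

text \<open>The free SLS-algebra over \<^typ>\<open>'k\<close> whose set of free generators is the type \<^typ>\<open>'x\<close>.\<close>

quotient_type (overloaded) ('x, 'k) free_sls = "'x word \<Rightarrow>\<^sub>0 'k::field" / "\<lambda>p q. p - q \<in> sls_ideal"
proof (rule equivpI)
  show "reflp (\<lambda>p q :: 'x word \<Rightarrow>\<^sub>0 'k. p - q \<in> sls_ideal)"
    by (simp add: reflp_def sls_ideal.zero)
  show "symp (\<lambda>p q :: 'x word \<Rightarrow>\<^sub>0 'k. p - q \<in> sls_ideal)"
    by (intro sympI) (drule sls_ideal_uminus, simp)
  show "transp (\<lambda>p q :: 'x word \<Rightarrow>\<^sub>0 'k. p - q \<in> sls_ideal)"
    by (intro transpI) (drule (1) sls_ideal.add, simp)
qed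

instantiation free_sls :: (type, field) ab_group_add
begin

lift_definition zero_free_sls :: "('a, 'b) free_sls" is 0 .
lift_definition plus_free_sls :: "('a, 'b) free_sls \<Rightarrow> ('a, 'b) free_sls \<Rightarrow> ('a, 'b) free_sls"
  is "(+)" by (simp only: add_diff_add sls_ideal.add)
lift_definition uminus_free_sls :: "('a, 'b) free_sls \<Rightarrow> ('a, 'b) free_sls"
  is uminus by (simp only: minus_diff_minus sls_ideal_uminus)
lift_definition minus_free_sls :: "('a, 'b) free_sls \<Rightarrow> ('a, 'b) free_sls \<Rightarrow> ('a, 'b) free_sls"
  is "(-)" by (drule (1) sls_ideal_diff) (simp add: algebra_simps)

instance
  by standard (transfer; simp add: sls_ideal.zero algebra_simps)+

end

lift_definition sls_scale :: "'k::field \<Rightarrow> ('x, 'k) free_sls \<Rightarrow> ('x, 'k) free_sls" is fscale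
  by (simp only: word.scale_right_diff_distrib[symmetric] sls_ideal.scale)

lift_definition sls_mul :: "('x, 'k::field) free_sls \<Rightarrow> ('x, 'k) free_sls \<Rightarrow> ('x, 'k) free_sls"
  is word_mul
  by (subst word.mul_diff_swap) (intro sls_ideal.add sls_ideal.mul_left sls_ideal.mul_right)

lift_definition sls_gen :: "'x \<Rightarrow> ('x, 'k::field) free_sls"
  is "\<lambda>x. Poly_Mapping.single (Letter x) 1" .

lemma nonassoc_algebra_sls: "nonassoc_algebra (sls_scale :: 'k::field \<Rightarrow> ('x, 'k) free_sls \<Rightarrow> _) sls_mul"
proof -
  interpret vector_space "sls_scale :: 'k \<Rightarrow> ('x, 'k) free_sls \<Rightarrow> _"
    by unfold_locales (transfer; simp add: sls_ideal.zero algebra_simps)+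
  show ?thesis
    by (unfold_locales; transfer)
       (simp_all add: sls_ideal.zero word.mr.add word.ml.add word.mr.scale word.ml.scale)
qed

lemma sls_algebra_free_sls: "sls_algebra (sls_scale :: 'k::field \<Rightarrow> ('x, 'k) free_sls \<Rightarrow> _) sls_mul"
proof -
  interpret nonassoc_algebra "sls_scale :: 'k \<Rightarrow> ('x, 'k) free_sls \<Rightarrow> _" sls_mul
    by (rule nonassoc_algebra_sls)
  show ?thesis
  proof
    fix x y z u :: "('x, 'k) free_sls"
    show "associator sls_mul x y z = associator sls_mul y x z"
      unfolding associator_def
      by transfer (rule sls_ideal.left_symmetric[unfolded associator_def])
    show "sls_mul (sls_mul (sls_mul x y) z) u = sls_mul (sls_mul (sls_mul x z) y) u"
      by transfer (rule sls_ideal.right_commutative)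
    show "associator sls_mul x (sls_mul y z) u = associator sls_mul y (sls_mul x z) u"
      unfolding associator_def
      by transfer (rule sls_ideal.associator_exchange[unfolded associator_def])
  qed
qed

primrec word_eval :: "('a \<Rightarrow> 'a \<Rightarrow> 'a) \<Rightarrow> ('x \<Rightarrow> 'a) \<Rightarrow> 'x word \<Rightarrow> 'a" where
  "word_eval mul f (Letter x) = f x"
| "word_eval mul f (Prod u v) = mul (word_eval mul f u) (word_eval mul f v)"

lemma (in nonassoc_algebra) lin_ext_word_eval_mul:
  "lin_ext scale (word_eval mul f) (word_mul p q) =
     mul (lin_ext scale (word_eval mul f) p) (lin_ext scale (word_eval mul f) q)"
proof -
  have vs: "vector_space scale" ..
  note lin = linear_lin_ext_comp[OF linear_lin_ext[OF vs]]
  have "lin_ext scale (word_eval mul f) (word_mul p q) =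
      lin_ext scale (\<lambda>u. lin_ext scale (\<lambda>v. mul (word_eval mul f u) (word_eval mul f v)) q) p"
    by (simp add: word_mul_def lin lin_ext_single[OF vs])
  also have "\<dots> = lin_ext scale (\<lambda>u. mul (word_eval mul f u) (lin_ext scale (word_eval mul f) q)) p"
    by (simp only: linear_lin_ext_comp[OF linear_mul_right])
  also have "\<dots> = mul (lin_ext scale (word_eval mul f) p) (lin_ext scale (word_eval mul f) q)"
    by (rule linear_lin_ext_comp[OF linear_mul_left, symmetric])
  finally show ?thesis .
qed

lemma (in sls_algebra) lin_ext_word_eval_sls_ideal:
  "p \<in> sls_ideal \<Longrightarrow> lin_ext scale (word_eval mul f) p = 0"
proof -
  interpret e: Vector_Spaces.linear fscale scale "lin_ext scale (word_eval mul f)"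
    by (rule linear_lin_ext[OF vector_space_axioms])
  note mul = lin_ext_word_eval_mul
  assume "p \<in> sls_ideal"
  then show ?thesis
  proof (induction rule: sls_ideal.induct)
    case (left_symmetric x y z)
    show ?case
      using sls_algebra.left_symmetric[OF sls_algebra_axioms]
      by (simp add: associator_def e.diff mul)
  next
    case (right_commutative x y z u)
    show ?case
      using sls_algebra.right_commutative[OF sls_algebra_axioms] by (simp add: e.diff mul)
  next
    case (associator_exchange x y z u)
    show ?case
      using sls_algebra.associator_exchange[OF sls_algebra_axioms]
      by (simp add: associator_def e.diff mul)
  qed (simp_all add: mul e.add e.scale)
qed

text \<open>The universal property.\<close>

theorem free_sls_universal:
  fixes f :: "'x \<Rightarrow> 'a::ab_group_add" and scale :: "'k::field \<Rightarrow> 'a \<Rightarrow> 'a"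
  assumes "sls_algebra scale mul"
  shows "\<exists>!\<phi> :: ('x, 'k) free_sls \<Rightarrow> 'a.
           algebra_hom sls_scale sls_mul scale mul \<phi> \<and> (\<forall>x. \<phi> (sls_gen x) = f x)"
proof -
  interpret A: sls_algebra scale mul by fact
  have vs: "vector_space scale" ..
  interpret S: nonassoc_algebra "sls_scale :: 'k \<Rightarrow> ('x, 'k) free_sls \<Rightarrow> _" sls_mul
    by (rule nonassoc_algebra_sls)
  let ?e = "lin_ext scale (word_eval mul f)"
  interpret e: Vector_Spaces.linear fscale scale ?e by (rule linear_lin_ext[OF vs])
  define \<phi> where "\<phi> a = ?e (rep_free_sls a)" for a :: "('x, 'k) free_sls"
  have \<phi>_abs: "\<phi> (abs_free_sls p) = ?e p" for p
  proof -
    have "rep_free_sls (abs_free_sls p) - p \<in> sls_ideal"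
      by (rule Quotient_rep_abs[OF Quotient_free_sls]) (simp add: sls_ideal.zero)
    then show ?thesis
      using A.lin_ext_word_eval_sls_ideal[of _ f] by (fastforce simp: \<phi>_def e.diff)
  qed
  have abs: "\<exists>p. a = abs_free_sls p" for a :: "('x, 'k) free_sls"
    by (metis Quotient_abs_rep[OF Quotient_free_sls])
  show ?thesis
  proof (rule ex1I[of _ \<phi>], intro conjI allI)
    have "Vector_Spaces.linear sls_scale scale \<phi>"
    proof (rule vs_linearI[OF S.vector_space_axioms vs])
      fix a b :: "('x, 'k) free_sls" and c
      obtain p q where pq: "a = abs_free_sls p" "b = abs_free_sls q" using abs by metis
      show "\<phi> (a + b) = \<phi> a + \<phi> b"
        by (simp add: pq plus_free_sls.abs_eq \<phi>_abs e.add)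
      show "\<phi> (sls_scale c a) = scale c (\<phi> a)"
        by (simp add: pq sls_scale.abs_eq \<phi>_abs e.scale)
    qed
    moreover have "\<phi> (sls_mul a b) = mul (\<phi> a) (\<phi> b)" for a b
    proof -
      obtain p q where pq: "a = abs_free_sls p" "b = abs_free_sls q" using abs by metis
      show ?thesis by (simp add: pq sls_mul.abs_eq \<phi>_abs A.lin_ext_word_eval_mul)
    qed
    ultimately show "algebra_hom sls_scale sls_mul scale mul \<phi>"
      by (simp add: algebra_hom_def)
    show "\<phi> (sls_gen x) = f x" for x
      by (simp add: sls_gen.abs_eq \<phi>_abs lin_ext_single[OF vs])
  next
    fix \<psi> :: "('x, 'k) free_sls \<Rightarrow> 'a"
    assume \<psi>: "algebra_hom sls_scale sls_mul scale mul \<psi> \<and> (\<forall>x. \<psi> (sls_gen x) = f x)"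
    then interpret \<psi>: Vector_Spaces.linear sls_scale scale \<psi> by (simp add: algebra_hom_def)
    define g where "g p = \<psi> (abs_free_sls p)" for p
    have g: "Vector_Spaces.linear fscale scale g"
      by (rule vs_linearI[OF vector_space_fscale vs])
         (simp_all add: g_def \<psi>.add \<psi>.scale flip: plus_free_sls.abs_eq sls_scale.abs_eq)
    have g_mul: "g (word_mul p q) = mul (g p) (g q)" for p q
      using \<psi> by (simp add: g_def algebra_hom_def flip: sls_mul.abs_eq)
    have pr: "Poly_Mapping.single (Prod u v) 1 =
        word_mul (Poly_Mapping.single u 1) (Poly_Mapping.single v (1 :: 'k))" for u v :: "'x word"
      by (simp add: word_mul_def lin_ext_single[OF vector_space_fscale])
    have "g (Poly_Mapping.single u 1) = word_eval mul f u" for u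
    proof (induction u)
      case (Letter x)
      then show ?case using \<psi> by (simp add: g_def flip: sls_gen.abs_eq)
    qed (simp add: pr g_mul)
    then have "g p = ?e p" for p
      using linear_lin_ext_comp[OF g, of "\<lambda>u. Poly_Mapping.single u 1" p] by simp
    then show "\<psi> = \<phi>"
      unfolding g_def using \<phi>_abs abs by (metis ext)
  qed
qed


section \<open>The free differential Perm-algebra\<close>

datatype 'x dword = DLetter 'x | DProd "'x dword" "'x dword" | DDer "'x dword"

definition dword_mul :: "('x dword \<Rightarrow>\<^sub>0 'k::field) \<Rightarrow> ('x dword \<Rightarrow>\<^sub>0 'k) \<Rightarrow> ('x dword \<Rightarrow>\<^sub>0 'k)" where
  "dword_mul p q =
     lin_ext fscale (\<lambda>u. lin_ext fscale (\<lambda>v. Poly_Mapping.single (DProd u v) 1) q) p"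

definition dword_der :: "('x dword \<Rightarrow>\<^sub>0 'k::field) \<Rightarrow> ('x dword \<Rightarrow>\<^sub>0 'k)" where
  "dword_der = lin_ext fscale (\<lambda>u. Poly_Mapping.single (DDer u) 1)"

text \<open>
  The two-sided ideal, closed under the operator \<^const>\<open>dword_der\<close>, that is generated by all
  instances of associativity, of $xyz = yxz$ and of the Leibniz rule.
\<close>

inductive_set permder_ideal :: "('x dword \<Rightarrow>\<^sub>0 'k::field) set" where
  zero: "0 \<in> permder_ideal"
| add: "p \<in> permder_ideal \<Longrightarrow> q \<in> permder_ideal \<Longrightarrow> p + q \<in> permder_ideal"
| scale: "p \<in> permder_ideal \<Longrightarrow> fscale c p \<in> permder_ideal"
| mul_left: "p \<in> permder_ideal \<Longrightarrow> dword_mul q p \<in> permder_ideal"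
| mul_right: "p \<in> permder_ideal \<Longrightarrow> dword_mul p q \<in> permder_ideal"
| der: "p \<in> permder_ideal \<Longrightarrow> dword_der p \<in> permder_ideal"
| assoc: "dword_mul (dword_mul x y) z - dword_mul x (dword_mul y z) \<in> permder_ideal"
| perm: "dword_mul (dword_mul x y) z - dword_mul (dword_mul y x) z \<in> permder_ideal"
| leibniz:
    "dword_der (dword_mul x y) - (dword_mul (dword_der x) y + dword_mul x (dword_der y))
      \<in> permder_ideal"

interpretation dword: nonassoc_algebra fscale dword_mul
proof -
  show "nonassoc_algebra fscale (dword_mul :: ('x dword \<Rightarrow>\<^sub>0 'k::field) \<Rightarrow> _)"
    unfolding dword_mul_def
    by (intro nonassoc_algebra.intro nonassoc_algebra_axioms.intro
        linear_lin_ext linear_lin_ext_pointwise vector_space_fscale)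
qed

interpretation dword_der: Vector_Spaces.linear fscale fscale dword_der
  unfolding dword_der_def by (rule linear_lin_ext[OF vector_space_fscale])

lemma permder_ideal_uminus: "p \<in> permder_ideal \<Longrightarrow> - p \<in> permder_ideal"
  using permder_ideal.scale[of p "- 1"] by simp

lemma permder_ideal_diff: "p \<in> permder_ideal \<Longrightarrow> q \<in> permder_ideal \<Longrightarrow> p - q \<in> permder_ideal"
  using permder_ideal.add[of p "- q"] permder_ideal_uminus[of q] by simp

text \<open>
  The free differential Perm-algebra over \<^typ>\<open>'k\<close> whose set of free generators is the type
  \<^typ>\<open>'x\<close>.
\<close>

quotient_type (overloaded) ('x, 'k) permder = "'x dword \<Rightarrow>\<^sub>0 'k::field" / "\<lambda>p q. p - q \<in> permder_ideal"
proof (rule equivpI)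
  show "reflp (\<lambda>p q :: 'x dword \<Rightarrow>\<^sub>0 'k. p - q \<in> permder_ideal)"
    by (simp add: reflp_def permder_ideal.zero)
  show "symp (\<lambda>p q :: 'x dword \<Rightarrow>\<^sub>0 'k. p - q \<in> permder_ideal)"
    by (intro sympI) (drule permder_ideal_uminus, simp)
  show "transp (\<lambda>p q :: 'x dword \<Rightarrow>\<^sub>0 'k. p - q \<in> permder_ideal)"
    by (intro transpI) (drule (1) permder_ideal.add, simp)
qed

instantiation permder :: (type, field) ab_group_add
begin

lift_definition zero_permder :: "('a, 'b) permder" is 0 .
lift_definition plus_permder :: "('a, 'b) permder \<Rightarrow> ('a, 'b) permder \<Rightarrow> ('a, 'b) permder"
  is "(+)" by (simp only: add_diff_add permder_ideal.add)
lift_definition uminus_permder :: "('a, 'b) permder \<Rightarrow> ('a, 'b) permder"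
  is uminus by (simp only: minus_diff_minus permder_ideal_uminus)
lift_definition minus_permder :: "('a, 'b) permder \<Rightarrow> ('a, 'b) permder \<Rightarrow> ('a, 'b) permder"
  is "(-)" by (drule (1) permder_ideal_diff) (simp add: algebra_simps)

instance
  by standard (transfer; simp add: permder_ideal.zero algebra_simps)+

end

lift_definition permder_scale :: "'k::field \<Rightarrow> ('x, 'k) permder \<Rightarrow> ('x, 'k) permder" is fscale
  by (simp only: dword.scale_right_diff_distrib[symmetric] permder_ideal.scale)

lift_definition permder_mul :: "('x, 'k::field) permder \<Rightarrow> ('x, 'k) permder \<Rightarrow> ('x, 'k) permder"
  is dword_mul
  by (subst dword.mul_diff_swap) (intro permder_ideal.add permder_ideal.mul_left permder_ideal.mul_right)

lift_definition permder_gen :: "'x \<Rightarrow> ('x, 'k::field) permder"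
  is "\<lambda>x. Poly_Mapping.single (DLetter x) 1" .

lift_definition permder_der :: "('x, 'k::field) permder \<Rightarrow> ('x, 'k) permder" is dword_der
  by (simp only: dword_der.diff[symmetric] permder_ideal.der)

lemma nonassoc_algebra_permder: "nonassoc_algebra (permder_scale :: 'k::field \<Rightarrow> ('x, 'k) permder \<Rightarrow> _) permder_mul"
proof -
  interpret vector_space "permder_scale :: 'k \<Rightarrow> ('x, 'k) permder \<Rightarrow> _"
    by unfold_locales (transfer; simp add: permder_ideal.zero algebra_simps)+
  show ?thesis
    by (unfold_locales; transfer)
       (simp_all add: permder_ideal.zero dword.mr.add dword.ml.add dword.mr.scale dword.ml.scale)
qed

lemma diff_perm_algebra_permder:
  "diff_perm_algebra (permder_scale :: 'k::field \<Rightarrow> ('x, 'k) permder \<Rightarrow> _) permder_mul permder_der"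
proof -
  interpret nonassoc_algebra "permder_scale :: 'k \<Rightarrow> ('x, 'k) permder \<Rightarrow> _" permder_mul
    by (rule nonassoc_algebra_permder)
  show ?thesis
  proof
    fix x y z :: "('x, 'k) permder" and c :: 'k
    show "permder_mul (permder_mul x y) z = permder_mul x (permder_mul y z)"
      by transfer (rule permder_ideal.assoc)
    show "permder_mul (permder_mul x y) z = permder_mul (permder_mul y x) z"
      by transfer (rule permder_ideal.perm)
    show "permder_der (permder_mul x y)
        = permder_mul (permder_der x) y + permder_mul x (permder_der y)"
      by transfer (rule permder_ideal.leibniz)
    show "permder_der (x + y) = permder_der x + permder_der y"
      by transfer (simp add: permder_ideal.zero dword_der.add)
    show "permder_der (permder_scale c x) = permder_scale c (permder_der x)"
      by transfer (simp add: permder_ideal.zero dword_der.scale)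
  qed
qed

primrec dword_eval ::
  "('a \<Rightarrow> 'a \<Rightarrow> 'a) \<Rightarrow> ('a \<Rightarrow> 'a) \<Rightarrow> ('x \<Rightarrow> 'a) \<Rightarrow> 'x dword \<Rightarrow> 'a" where
  "dword_eval mul d f (DLetter x) = f x"
| "dword_eval mul d f (DProd u v) = mul (dword_eval mul d f u) (dword_eval mul d f v)"
| "dword_eval mul d f (DDer u) = d (dword_eval mul d f u)"

lemma (in diff_perm_algebra) lin_ext_dword_eval_mul:
  "lin_ext scale (dword_eval mul d f) (dword_mul p q) =
     mul (lin_ext scale (dword_eval mul d f) p) (lin_ext scale (dword_eval mul d f) q)"
proof -
  have vs: "vector_space scale" ..
  note lin = linear_lin_ext_comp[OF linear_lin_ext[OF vs]]
  have "lin_ext scale (dword_eval mul d f) (dword_mul p q) =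
      lin_ext scale (\<lambda>u. lin_ext scale (\<lambda>v. mul (dword_eval mul d f u) (dword_eval mul d f v)) q) p"
    by (simp add: dword_mul_def lin lin_ext_single[OF vs])
  also have "\<dots> = lin_ext scale (\<lambda>u. mul (dword_eval mul d f u) (lin_ext scale (dword_eval mul d f) q)) p"
    by (simp only: linear_lin_ext_comp[OF linear_mul_right])
  also have "\<dots> = mul (lin_ext scale (dword_eval mul d f) p) (lin_ext scale (dword_eval mul d f) q)"
    by (rule linear_lin_ext_comp[OF linear_mul_left, symmetric])
  finally show ?thesis .
qed

lemma (in diff_perm_algebra) lin_ext_dword_eval_der:
  "lin_ext scale (dword_eval mul d f) (dword_der p) = d (lin_ext scale (dword_eval mul d f) p)"
proof -
  have vs: "vector_space scale" ..
  show ?thesis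
    by (simp add: dword_der_def linear_lin_ext_comp[OF linear_lin_ext[OF vs]]
        lin_ext_single[OF vs] linear_lin_ext_comp[OF linear_d])
qed

lemma (in diff_perm_algebra) lin_ext_dword_eval_permder_ideal:
  "p \<in> permder_ideal \<Longrightarrow> lin_ext scale (dword_eval mul d f) p = 0"
proof -
  interpret e: Vector_Spaces.linear fscale scale "lin_ext scale (dword_eval mul d f)"
    by (rule linear_lin_ext[OF vector_space_axioms])
  interpret d: Vector_Spaces.linear scale scale d by (rule linear_d)
  note hom = lin_ext_dword_eval_mul lin_ext_dword_eval_der
  assume "p \<in> permder_ideal"
  then show ?thesis
  proof (induction rule: permder_ideal.induct)
    case (assoc x y z)
    show ?case by (simp add: e.diff hom mul_assoc)
  next
    case (perm x y z)
    show ?case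
      using perm_algebra.perm[OF perm_algebra_axioms] by (simp add: e.diff hom)
  next
    case (leibniz x y)
    show ?case
      using diff_perm_algebra.leibniz[OF diff_perm_algebra_axioms]
      by (simp add: e.diff e.add hom)
  qed (simp_all add: hom e.add e.scale)
qed

text \<open>The universal property.\<close>

theorem permder_universal:
  fixes f :: "'x \<Rightarrow> 'a::ab_group_add" and scale :: "'k::field \<Rightarrow> 'a \<Rightarrow> 'a"
  assumes "diff_perm_algebra scale mul d"
  shows "\<exists>!\<phi> :: ('x, 'k) permder \<Rightarrow> 'a.
           algebra_hom permder_scale permder_mul scale mul \<phi> \<and>
           (\<forall>a. \<phi> (permder_der a) = d (\<phi> a)) \<and> (\<forall>x. \<phi> (permder_gen x) = f x)"
proof -
  interpret A: diff_perm_algebra scale mul d by fact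
  have vs: "vector_space scale" ..
  interpret S: nonassoc_algebra "permder_scale :: 'k \<Rightarrow> ('x, 'k) permder \<Rightarrow> _" permder_mul
    by (rule nonassoc_algebra_permder)
  let ?e = "lin_ext scale (dword_eval mul d f)"
  interpret e: Vector_Spaces.linear fscale scale ?e by (rule linear_lin_ext[OF vs])
  define \<phi> where "\<phi> a = ?e (rep_permder a)" for a :: "('x, 'k) permder"
  have \<phi>_abs: "\<phi> (abs_permder p) = ?e p" for p
  proof -
    have "rep_permder (abs_permder p) - p \<in> permder_ideal"
      by (rule Quotient_rep_abs[OF Quotient_permder]) (simp add: permder_ideal.zero)
    then show ?thesis
      using A.lin_ext_dword_eval_permder_ideal[of _ f] by (fastforce simp: \<phi>_def e.diff)
  qed
  have abs: "\<exists>p. a = abs_permder p" for a :: "('x, 'k) permder"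
    by (metis Quotient_abs_rep[OF Quotient_permder])
  show ?thesis
  proof (rule ex1I[of _ \<phi>], intro conjI allI)
    have "Vector_Spaces.linear permder_scale scale \<phi>"
    proof (rule vs_linearI[OF S.vector_space_axioms vs])
      fix a b :: "('x, 'k) permder" and c
      obtain p q where pq: "a = abs_permder p" "b = abs_permder q" using abs by metis
      show "\<phi> (a + b) = \<phi> a + \<phi> b"
        by (simp add: pq plus_permder.abs_eq \<phi>_abs e.add)
      show "\<phi> (permder_scale c a) = scale c (\<phi> a)"
        by (simp add: pq permder_scale.abs_eq \<phi>_abs e.scale)
    qed
    moreover have "\<phi> (permder_mul a b) = mul (\<phi> a) (\<phi> b)" for a b
    proof -
      obtain p q where pq: "a = abs_permder p" "b = abs_permder q" using abs by metis
      show ?thesis by (simp add: pq permder_mul.abs_eq \<phi>_abs A.lin_ext_dword_eval_mul)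
    qed
    ultimately show "algebra_hom permder_scale permder_mul scale mul \<phi>"
      by (simp add: algebra_hom_def)
    show "\<phi> (permder_der a) = d (\<phi> a)" for a
    proof -
      obtain p where p: "a = abs_permder p" using abs by metis
      show ?thesis by (simp add: p permder_der.abs_eq \<phi>_abs A.lin_ext_dword_eval_der)
    qed
    show "\<phi> (permder_gen x) = f x" for x
      by (simp add: permder_gen.abs_eq \<phi>_abs lin_ext_single[OF vs])
  next
    fix \<psi> :: "('x, 'k) permder \<Rightarrow> 'a"
    assume \<psi>: "algebra_hom permder_scale permder_mul scale mul \<psi> \<and>
      (\<forall>a. \<psi> (permder_der a) = d (\<psi> a)) \<and> (\<forall>x. \<psi> (permder_gen x) = f x)"
    then interpret \<psi>: Vector_Spaces.linear permder_scale scale \<psi> by (simp add: algebra_hom_def)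
    define g where "g p = \<psi> (abs_permder p)" for p
    have g: "Vector_Spaces.linear fscale scale g"
      by (rule vs_linearI[OF vector_space_fscale vs])
         (simp_all add: g_def \<psi>.add \<psi>.scale flip: plus_permder.abs_eq permder_scale.abs_eq)
    have g_mul: "g (dword_mul p q) = mul (g p) (g q)" for p q
      using \<psi> by (simp add: g_def algebra_hom_def flip: permder_mul.abs_eq)
    have g_der: "g (dword_der p) = d (g p)" for p
      using \<psi> by (simp add: g_def flip: permder_der.abs_eq)
    have dr: "Poly_Mapping.single (DDer u) 1 =
        dword_der (Poly_Mapping.single u (1 :: 'k))" for u :: "'x dword"
      by (simp add: dword_der_def lin_ext_single[OF vector_space_fscale])
    have pr: "Poly_Mapping.single (DProd u v) 1 =
        dword_mul (Poly_Mapping.single u 1) (Poly_Mapping.single v (1 :: 'k))" for u v :: "'x dword"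
      by (simp add: dword_mul_def lin_ext_single[OF vector_space_fscale])
    have "g (Poly_Mapping.single u 1) = dword_eval mul d f u" for u
    proof (induction u)
      case (DLetter x)
      then show ?case using \<psi> by (simp add: g_def flip: permder_gen.abs_eq)
    qed (simp_all add: pr dr g_mul g_der)
    then have "g p = ?e p" for p
      using linear_lin_ext_comp[OF g, of "\<lambda>u. Poly_Mapping.single u 1" p] by simp
    then show "\<psi> = \<phi>"
      unfolding g_def using \<phi>_abs abs by (metis ext)
  qed
qed

definition permder_circ :: "('x, 'k::field) permder \<Rightarrow> ('x, 'k) permder \<Rightarrow> ('x, 'k) permder" where
  "permder_circ f g = permder_mul f (permder_der g)"

lemma nonassoc_algebra_permder_circ:
  "nonassoc_algebra (permder_scale :: 'k::field \<Rightarrow> ('x, 'k) permder \<Rightarrow> _) permder_circ"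
proof -
  interpret diff_perm_algebra
    "permder_scale :: 'k \<Rightarrow> ('x, 'k) permder \<Rightarrow> _" permder_mul permder_der
    by (rule diff_perm_algebra_permder)
  interpret d: Vector_Spaces.linear
    "permder_scale :: 'k \<Rightarrow> ('x, 'k) permder \<Rightarrow> _" permder_scale permder_der
    by (rule linear_d)
  show ?thesis
    by unfold_locales
       (simp_all add: permder_circ_def d.add d.scale mr.add ml.add mr.scale ml.scale)
qed

end

(* In an SLS-algebra the symmetric brace {a1,...,an | z} is obtained from the product by the recursion
   {a,as | z} = a {as | z} - sum_i {..., a ai, ... | z}; for f d(g) it is the monomial a1 ... an d^n(z).
   Left symmetry makes it symmetric in the ai and makes f -> {f,as | z} a polynomial in right
   multiplications. These commute modulo the left annihilator (second identity), and the third identity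
   yields {T f, b, ... | z} = {T b, f, ... | z} for every such operator T. Hence iterated braces
   {...{{x,as | y}, bs | z}..., cs | w} of generators span the free SLS-algebra, and such an element
   depends only on the monomial that it represents in the free differential Perm-algebra. Distinct
   monomials are linearly independent there, so the canonical homomorphism is injective. *)

theory Submission
  imports Defs "HOL-Library.Multiset"
begin

section \<open>Symmetric braces\<close>

text \<open>Swaps bring the head of \<open>xs\<close> to the front of \<open>ys\<close>; then induct
  on the tails. They are assumed at the length of \<open>xs\<close>, where \<open>brace_mset\<close>
  and \<open>brace_chain_letters\<close> can supply them.\<close>

lemma adjacent_swaps_invariant:
  assumes swap: "\<And>us a b vs. length us + length vs + 2 = length xs \<Longrightarrow>
      F (us @ a # b # vs) = F (us @ b # a # vs)"
    and "mset xs = mset ys"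
  shows "F xs = F ys"
  using assms
proof (induction xs arbitrary: F ys)
  case (Cons x xs)
  note swap = Cons.prems(1)
  have "x \<in> set ys" using Cons.prems(2) by (metis list.set_intros(1) mset_eq_setD)
  then obtain us vs where ys: "ys = us @ x # vs" by (meson split_list)
  then have eq: "mset xs = mset (us @ vs)" using Cons.prems(2) by simp
  \<comment> \<open>\<open>x\<close> travels left through \<open>us\<close>; the prefix
    \<open>ws\<close> is general because the induction shifts letters of \<open>us\<close> into
    it.\<close>
  have "F (ws @ us @ x # vs) = F (ws @ x # us @ vs)" if "length ws + length us = n"
    "length us + length vs + length ws = length xs" for us ws n
    using that
  proof (induction us arbitrary: ws)
    case (Cons u us)
    have "F (ws @ (u # us) @ x # vs) = F ((ws @ [u]) @ us @ x # vs)" by simp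
    also have "\<dots> = F ((ws @ [u]) @ x # us @ vs)" using Cons.prems by (intro Cons.IH) simp_all
    also have "\<dots> = F (ws @ x # (u # us) @ vs)"
      using Cons.prems swap[of ws "us @ vs" u x] by simp
    finally show ?case .
  qed simp
  from this[of "[]" us] mset_eq_length[OF eq] have "F ys = F (x # us @ vs)" by (simp add: ys)
  moreover have "F (x # xs) = F (x # us @ vs)"
    using Cons.prems(1)[of "x # _"] by (intro Cons.IH[of "\<lambda>l. F (x # l)", OF _ eq]) simp
  ultimately show ?case by simp
qed simp

text \<open>The lists obtained from \<open>cs\<close> by multiplying one entry by \<open>a\<close> on the left, so that sums over
  them describe the derivation that extends left multiplication by \<open>a\<close>.\<close>

primrec act_lists :: "('a \<Rightarrow> 'a \<Rightarrow> 'a) \<Rightarrow> 'a \<Rightarrow> 'a list \<Rightarrow> 'a list list" where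
  "act_lists mul a [] = []"
| "act_lists mul a (c # cs) = (mul a c # cs) # map ((#) c) (act_lists mul a cs)"

lemma length_act_lists: "l \<in> set (act_lists mul a cs) \<Longrightarrow> length l = length cs"
  by (induction cs arbitrary: l) auto

lemma act_lists_memE:
  assumes "l \<in> set (act_lists mul a cs)"
  obtains us c vs where "cs = us @ c # vs" "l = us @ mul a c # vs"
  using assms
proof (induction cs arbitrary: l thesis)
  case (Cons c cs)
  show ?case
  proof (cases "l = mul a c # cs")
    case True
    then show ?thesis using Cons.prems(1)[of "[]" c cs] by simp
  next
    case False
    then obtain l' where l': "l' \<in> set (act_lists mul a cs)" "l = c # l'" using Cons.prems by auto
    obtain us e vs where "cs = us @ e # vs" "l' = us @ mul a e # vs"
      using Cons.IH[OF _ l'(1)] by metis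
    then show ?thesis using l' Cons.prems(1)[of "c # us" e vs] by simp
  qed
qed simp

text \<open>Hence a sum over \<open>act_lists\<close> of a function that ignores order depends only
  on the multiset of entries.\<close>

lemma mset_act_lists:
  "mset (map mset (act_lists mul a cs)) =
     image_mset (\<lambda>c. mset cs - {#c#} + {#mul a c#}) (mset cs)"
proof (induction cs)
  case (Cons c cs)
  have "mset (map mset (act_lists mul a (c # cs))) =
      add_mset (add_mset (mul a c) (mset cs))
        (image_mset (add_mset c) (mset (map mset (act_lists mul a cs))))"
    by (simp add: multiset.map_comp o_def)
  also have "\<dots> = add_mset (add_mset (mul a c) (mset cs))
      (image_mset (\<lambda>e. mset (c # cs) - {#e#} + {#mul a e#}) (mset cs))"
    unfolding Cons.IH multiset.map_comp o_def
    by (intro arg_cong[where f = "add_mset _"] image_mset_cong) auto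
  finally show ?case by simp
qed simp

lemma sum_act_lists_cong:
  assumes "mset as = mset bs"
    and "\<And>l l'. length l = length as \<Longrightarrow> mset l = mset l' \<Longrightarrow> g l = g l'"
  shows "(\<Sum>l\<leftarrow>act_lists mul a as. g l) = (\<Sum>l\<leftarrow>act_lists mul a bs. g l :: 'b::comm_monoid_add)"
proof -
  \<comment> \<open>\<open>G\<close> is \<open>g\<close> descended to multisets; the chosen
    representative has the right length, so the choice does not matter.\<close>
  define G where "G M = g (SOME l. mset l = M)" for M
  have G: "g l = G (mset l)" if "length l = length as" for l
    unfolding G_def by (rule assms(2)[OF that], rule sym, rule someI_ex) auto
  have len: "length as = length bs" using assms(1) by (rule mset_eq_length)
  have *: "(\<Sum>l\<leftarrow>act_lists mul a xs. g l) = (\<Sum>M\<in>#mset (map mset (act_lists mul a xs)). G M)"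
    if "length xs = length as" for xs
  proof -
    have "(\<Sum>l\<leftarrow>act_lists mul a xs. g l) = (\<Sum>l\<leftarrow>act_lists mul a xs. G (mset l))"
      by (intro arg_cong[where f = sum_list] map_cong refl G) (simp add: length_act_lists that)
    then show ?thesis
      by (simp add: multiset.map_comp o_def flip: sum_mset_sum_list)
  qed
  show ?thesis using assms(1) len by (simp add: * mset_act_lists del: mset_map)
qed

text \<open>The symmetric brace $\{a_1,\dots,a_n \mid z\}$, which is $a_1 \cdots a_n\, d^n(z)$ if
  the product is $a \circ b = a\, d(b)$.\<close>

function brace :: "('a::ab_group_add \<Rightarrow> 'a \<Rightarrow> 'a) \<Rightarrow> 'a list \<Rightarrow> 'a \<Rightarrow> 'a" where
  "brace mul [] z = z"
| "brace mul (a # as) z = mul a (brace mul as z) - (\<Sum>l\<leftarrow>act_lists mul a as. brace mul l z)"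
  by pat_completeness auto
termination
  by (relation "measure (\<lambda>(mul, as, z). length as)") (auto simp: length_act_lists)

section \<open>Additivity of the brace in each argument\<close>

text \<open>Confined to one length so that it can be proved for braces by induction on the
  length.\<close>

definition multi_additive :: "nat \<Rightarrow> ('a::ab_group_add list \<Rightarrow> 'a) \<Rightarrow> bool" where
  "multi_additive n g \<longleftrightarrow> (\<forall>xs x y ys. length xs + length ys + 1 = n \<longrightarrow>
     g (xs @ (x + y) # ys) = g (xs @ x # ys) + g (xs @ y # ys))"

lemma multi_additiveD:
  "multi_additive n g \<Longrightarrow> length xs + length ys + 1 = n \<Longrightarrow>
    g (xs @ (x + y) # ys) = g (xs @ x # ys) + g (xs @ y # ys)"
  by (auto simp: multi_additive_def)

lemma multi_additive_hd:
  "multi_additive (Suc (length ys)) g \<Longrightarrow> g ((x + y) # ys) = g (x # ys) + g (y # ys)"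
  using multi_additiveD[of _ g "[]"] by simp

lemma multi_additive_Cons: "multi_additive (Suc n) g \<Longrightarrow> multi_additive n (\<lambda>l. g (c # l))"
  unfolding multi_additive_def by (metis add_Suc append_Cons length_Cons)

context nonassoc_algebra
begin

notation mul (infixl "\<cdot>" 70)

lemma sum_act_lists_add:
  assumes "multi_additive (length cs) g"
  shows "(\<Sum>l\<leftarrow>act_lists mul (x + y) cs. g l) =
    (\<Sum>l\<leftarrow>act_lists mul x cs. g l) + (\<Sum>l\<leftarrow>act_lists mul y cs. g l)"
  using assms
proof (induction cs arbitrary: g)
  case (Cons c cs)
  have "multi_additive (length cs) (\<lambda>l. g (c # l))"
    using Cons.prems by (simp add: multi_additive_Cons)
  from Cons.IH[OF this] Cons.prems show ?case
    by (simp add: ml.add multi_additive_hd o_def algebra_simps)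
qed simp

lemma sum_act_lists_add_entry:
  assumes "multi_additive (length xs + length ys + 1) g"
  shows "(\<Sum>l\<leftarrow>act_lists mul a (xs @ (x + y) # ys). g l) =
    (\<Sum>l\<leftarrow>act_lists mul a (xs @ x # ys). g l) + (\<Sum>l\<leftarrow>act_lists mul a (xs @ y # ys). g l)"
  using assms
proof (induction xs arbitrary: g)
  case Nil
  have "(\<Sum>l\<leftarrow>act_lists mul a ys. g ((x + y) # l)) =
      (\<Sum>l\<leftarrow>act_lists mul a ys. g (x # l) + g (y # l))"
    using Nil
    by (intro arg_cong[where f = sum_list] map_cong refl multi_additive_hd)
       (simp add: length_act_lists)
  then show ?case
    using Nil by (simp add: mr.add multi_additive_hd o_def sum_list_addf algebra_simps)
next
  case (Cons c xs)
  have "multi_additive (length xs + length ys + 1) (\<lambda>l. g (c # l))"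
    using Cons.prems by (simp add: multi_additive_Cons)
  from Cons.IH[OF this] show ?case
    using multi_additiveD[OF Cons.prems, of "a \<cdot> c # xs" ys x y]
    by (simp add: o_def algebra_simps)
qed

lemma multi_additive_brace: "multi_additive n (\<lambda>l. brace mul l z)"
proof (induction n)
  case 0
  show ?case by (simp add: multi_additive_def)
next
  case (Suc n)
  show ?case
    unfolding multi_additive_def
  proof (intro allI impI)
    fix x y :: 'a and xs ys :: "'a list"
    assume len: "length xs + length ys + 1 = Suc n"
    show "brace mul (xs @ (x + y) # ys) z = brace mul (xs @ x # ys) z + brace mul (xs @ y # ys) z"
    proof (cases xs)
      case Nil
      then show ?thesis using len Suc.IH by (simp add: ml.add sum_act_lists_add)
    next
      case (Cons c xs')
      then have n: "n = length xs' + length ys + 1" using len by simp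
      show ?thesis
        using multi_additiveD[OF Suc.IH, of xs' ys x y] Suc.IH n
        by (simp add: Cons mr.add sum_act_lists_add_entry)
    qed
  qed
qed

lemma brace_hd_add: "brace mul ((x + y) # as) z = brace mul (x # as) z + brace mul (y # as) z"
  by (rule multi_additive_hd[OF multi_additive_brace])

lemma brace_hd_0: "brace mul (0 # as) z = 0"
  using brace_hd_add[of 0 0] by simp

lemma brace_hd_diff: "brace mul ((x - y) # as) z = brace mul (x # as) z - brace mul (y # as) z"
  using brace_hd_add[of "x - y" y] by simp

end

section \<open>Symmetry of the brace\<close>

context sls_algebra
begin

text \<open>Left symmetry says that the commutator of left multiplications by \<open>a\<close> and
  \<open>b\<close> is left multiplication by \<open>a \<cdot> b - b \<cdot> a\<close>.\<close>

lemma left_symmetric_sum: "b \<cdot> (a \<cdot> c) + (a \<cdot> b) \<cdot> c = a \<cdot> (b \<cdot> c) + (b \<cdot> a) \<cdot> c"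
  using left_symmetric[of a b c] unfolding associator_def by (simp add: algebra_simps)

text \<open>The same commutator relation for derivations on lists: terms in which \<open>a\<close>
  and \<open>b\<close> hit different entries agree on both sides.\<close>

lemma sum_act_lists_commute:
  assumes "multi_additive (length cs) g"
  shows "(\<Sum>l\<leftarrow>act_lists mul a cs. \<Sum>l'\<leftarrow>act_lists mul b l. g l') + (\<Sum>l\<leftarrow>act_lists mul (a \<cdot> b) cs. g l) =
    (\<Sum>l\<leftarrow>act_lists mul b cs. \<Sum>l'\<leftarrow>act_lists mul a l. g l') + (\<Sum>l\<leftarrow>act_lists mul (b \<cdot> a) cs. g l)"
  using assms
proof (induction cs arbitrary: g)
  case (Cons c cs)
  have 1: "multi_additive (length cs) (\<lambda>l. g (c # l))"
    using Cons.prems by (simp add: multi_additive_Cons)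
  have 2: "g (b \<cdot> (a \<cdot> c) # cs) + g ((a \<cdot> b) \<cdot> c # cs) = g (a \<cdot> (b \<cdot> c) # cs) + g ((b \<cdot> a) \<cdot> c # cs)"
    using Cons.prems left_symmetric_sum[of b a c] by (simp flip: multi_additive_hd)
  show ?case
    using Cons.IH[OF 1] 2 by (simp add: o_def sum_list_addf algebra_simps)
qed simp

lemma brace_swap_hd: "brace mul (a # b # cs) z = brace mul (b # a # cs) z"
proof -
  \<comment> \<open>The recursion is applied twice. The first group is symmetric in \<open>a\<close>
    and \<open>b\<close> by left symmetry, the second visibly, the third by
    \<open>sum_act_lists_commute\<close>.\<close>
  have *: "brace mul (a # b # cs) z =
      (a \<cdot> (b \<cdot> brace mul cs z) - (a \<cdot> b) \<cdot> brace mul cs z)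
      - ((\<Sum>l\<leftarrow>act_lists mul b cs. a \<cdot> brace mul l z) + (\<Sum>l\<leftarrow>act_lists mul a cs. b \<cdot> brace mul l z))
      + ((\<Sum>l\<leftarrow>act_lists mul a cs. \<Sum>l'\<leftarrow>act_lists mul b l. brace mul l' z)
         + (\<Sum>l\<leftarrow>act_lists mul (a \<cdot> b) cs. brace mul l z))" for a b
  proof -
    have "x \<cdot> sum_list (map g xs) = (\<Sum>l\<leftarrow>xs. x \<cdot> g l)" for x and g :: "'b list \<Rightarrow> 'b" and xs
      by (induction xs) (simp_all add: mr.add mr.zero)
    then show ?thesis
      by (simp add: mr.diff o_def sum_list_subtractf algebra_simps)
  qed
  show ?thesis
    using left_symmetric_sum[of b a "brace mul cs z"]
      sum_act_lists_commute[OF multi_additive_brace[where z = z], where cs = cs and a = a and b = b]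
    unfolding *[of a b] *[of b a]
    by (simp add: algebra_simps)
qed

text \<open>The first two arguments swap by \<open>brace_swap_hd\<close>; a swap further back
  happens inside the shorter lists of the recursion.\<close>

lemma brace_mset:
  assumes "mset as = mset bs"
  shows "brace mul as z = brace mul bs z"
  using assms
proof (induction "length as" arbitrary: as bs rule: less_induct)
  case less
  have "brace mul (us @ a # b # vs) z = brace mul (us @ b # a # vs) z"
    if len: "length us + length vs + 2 = length as" for us a b vs
  proof (cases us)
    case Nil
    then show ?thesis by (simp only: append_Nil brace_swap_hd)
  next
    case (Cons c us')
    let ?l = "us' @ a # b # vs" and ?l' = "us' @ b # a # vs"
    have eq: "mset ?l = mset ?l'" and n: "length ?l < length as"
      using len by (simp_all add: Cons add_mset_commute)
    have "brace mul ?l z = brace mul ?l' z" by (rule less.hyps[OF n eq])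
    moreover have "(\<Sum>l\<leftarrow>act_lists mul c ?l. brace mul l z) = (\<Sum>l\<leftarrow>act_lists mul c ?l'. brace mul l z)"
      using n by (intro sum_act_lists_cong[OF eq] less.hyps) simp_all
    ultimately show ?thesis by (simp add: Cons)
  qed
  then show ?case
    using less.prems by (rule adjacent_swaps_invariant[where F = "\<lambda>l. brace mul l z"])
qed

end

section \<open>Right operators and the exchange property\<close>

text \<open>The ring of operators generated by the identity and the right multiplications; the
  recursion for braces has integer coefficients.\<close>

inductive_set right_ops :: "('a::ab_group_add \<Rightarrow> 'a \<Rightarrow> 'a) \<Rightarrow> ('a \<Rightarrow> 'a) set" for mul where
  ident: "(\<lambda>f. f) \<in> right_ops mul"
| right: "(\<lambda>f. mul f y) \<in> right_ops mul"
| add: "S \<in> right_ops mul \<Longrightarrow> T \<in> right_ops mul \<Longrightarrow> (\<lambda>f. S f + T f) \<in> right_ops mul"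
| diff: "S \<in> right_ops mul \<Longrightarrow> T \<in> right_ops mul \<Longrightarrow> (\<lambda>f. S f - T f) \<in> right_ops mul"
| comp: "S \<in> right_ops mul \<Longrightarrow> T \<in> right_ops mul \<Longrightarrow> (\<lambda>f. S (T f)) \<in> right_ops mul"

definition left_annihilator :: "('a \<Rightarrow> 'a \<Rightarrow> 'a::zero) \<Rightarrow> 'a set" where
  "left_annihilator mul = {a. \<forall>u. mul a u = 0}"

context nonassoc_algebra
begin

lemma linear_right_ops: "T \<in> right_ops mul \<Longrightarrow> Vector_Spaces.linear scale scale T"
proof (induction rule: right_ops.induct)
  case ident
  show ?case by (rule vs_linearI) (auto intro: vector_space_axioms)
next
  case (right y)
  show ?case by (rule linear_mul_left)
next
  case (add S T)
  then interpret S: Vector_Spaces.linear scale scale S + T: Vector_Spaces.linear scale scale T by auto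
  show ?case
    by (rule vs_linearI)
       (auto intro: vector_space_axioms simp: S.add T.add S.scale T.scale scale_right_distrib)
next
  case (diff S T)
  then interpret S: Vector_Spaces.linear scale scale S + T: Vector_Spaces.linear scale scale T by auto
  show ?case
    by (rule vs_linearI)
       (auto intro: vector_space_axioms simp: S.add T.add S.scale T.scale scale_right_diff_distrib)
next
  case (comp S T)
  then interpret S: Vector_Spaces.linear scale scale S + T: Vector_Spaces.linear scale scale T by auto
  show ?case
    by (rule vs_linearI) (auto intro: vector_space_axioms simp: S.add T.add S.scale T.scale)
qed

lemma right_ops_add: "T \<in> right_ops mul \<Longrightarrow> T (x + y) = T x + T y"
  using linear_right_ops[of T] by (metis module_hom.add module_hom_iff_linear)

lemma right_ops_diff: "T \<in> right_ops mul \<Longrightarrow> T (x - y) = T x - T y"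
  by (metis right_ops_add add_diff_cancel_right' diff_add_cancel)

lemma right_ops_sum_list:
  assumes "\<And>x. x \<in> set xs \<Longrightarrow> h x \<in> right_ops mul"
  shows "(\<lambda>f. \<Sum>x\<leftarrow>xs. h x f) \<in> right_ops mul"
  using assms
proof (induction xs)
  case Nil
  show ?case using right_ops.diff[OF right_ops.ident right_ops.ident] by simp
next
  case (Cons x xs)
  then show ?case using right_ops.add[of "h x" mul "\<lambda>f. \<Sum>x\<leftarrow>xs. h x f"] by simp
qed

lemma left_annihilator_diff:
  "a \<in> left_annihilator mul \<Longrightarrow> b \<in> left_annihilator mul \<Longrightarrow> a - b \<in> left_annihilator mul"
  by (simp add: left_annihilator_def ml.diff)

lemma left_annihilator_add:
  "a \<in> left_annihilator mul \<Longrightarrow> b \<in> left_annihilator mul \<Longrightarrow> a + b \<in> left_annihilator mul"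
  by (simp add: left_annihilator_def ml.add)

lemma left_annihilator_0: "0 \<in> left_annihilator mul"
  by (simp add: left_annihilator_def ml.zero)

lemma right_ops_left_annihilator:
  "T \<in> right_ops mul \<Longrightarrow> a \<in> left_annihilator mul \<Longrightarrow> T a \<in> left_annihilator mul"
proof (induction arbitrary: a rule: right_ops.induct)
  case (right y)
  then have "a \<cdot> y = 0" by (simp add: left_annihilator_def)
  then show ?case by (simp add: left_annihilator_0)
qed (auto simp: left_annihilator_add left_annihilator_diff)

end

section \<open>Right operators in an SLS-algebra\<close>

context sls_algebra
begin

text \<open>Left symmetry expresses the commutator of left multiplication by \<open>a\<close> with
  right multiplication by \<open>y\<close> through right multiplications. Taking commutators is a
  derivation, so this extends to all of \<open>right_ops\<close>.\<close>

lemma right_ops_commutator: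
  assumes "T \<in> right_ops mul"
  shows "(\<lambda>f. a \<cdot> T f - T (a \<cdot> f)) \<in> right_ops mul"
  using assms
proof (induction rule: right_ops.induct)
  case ident
  show ?case using right_ops.diff[OF right_ops.ident right_ops.ident] by simp
next
  case (right y)
  have "a \<cdot> (f \<cdot> y) - (a \<cdot> f) \<cdot> y = f \<cdot> (a \<cdot> y) - (f \<cdot> a) \<cdot> y" for f
    using left_symmetric_sum[of a f y] by (simp add: algebra_simps)
  then show ?case
    using right_ops.diff[OF right_ops.right[of mul "a \<cdot> y"]
        right_ops.comp[OF right_ops.right[of mul y] right_ops.right[of mul a]]] by simp
next
  case (add S T)
  from right_ops.add[OF add.IH] show ?case by (simp add: mr.add algebra_simps)
next
  case (diff S T)
  from right_ops.diff[OF diff.IH] show ?case by (simp add: mr.diff algebra_simps)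
next
  case (comp S T)
  have eq: "a \<cdot> S (T f) - S (T (a \<cdot> f)) =
      (a \<cdot> S (T f) - S (a \<cdot> T f)) + S (a \<cdot> T f - T (a \<cdot> f))" for f
    using comp.hyps by (simp add: right_ops_diff)
  show ?case
    unfolding eq using right_ops.add[OF right_ops.comp[OF comp.IH(1) comp.hyps(2)]
        right_ops.comp[OF comp.hyps(1) comp.IH(2)]] by simp
qed

text \<open>With the second argument moved to the front, the recursion gives the commutator of its
  left multiplication with a shorter brace operator, minus shorter brace operators.\<close>

lemma brace_right_op: "(\<lambda>f. brace mul (f # as) z) \<in> right_ops mul"
proof (induction "length as" arbitrary: as)
  case 0
  then show ?case using right_ops.right by simp
next
  case (Suc n)
  then obtain a bs where as: "as = a # bs" "length bs = n" by (cases as) auto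
  let ?T = "\<lambda>f. brace mul (f # bs) z"
  have T: "?T \<in> right_ops mul" using Suc.hyps(1) as by simp
  have "brace mul (f # as) z =
      (a \<cdot> ?T f - ?T (a \<cdot> f)) - (\<Sum>l\<leftarrow>act_lists mul a bs. brace mul (f # l) z)" for f
    unfolding as brace_swap_hd[of f] by (simp add: o_def algebra_simps)
  moreover have "(\<lambda>f. \<Sum>l\<leftarrow>act_lists mul a bs. brace mul (f # l) z) \<in> right_ops mul"
    by (rule right_ops_sum_list) (metis Suc.hyps(1) as(2) length_act_lists)
  ultimately show ?case
    using right_ops.diff[OF right_ops_commutator[OF T]] by simp
qed

text \<open>For right multiplications this is the second identity. It extends because
  \<open>right_ops\<close> preserves the left annihilator; the induction is on \<open>S\<close>,
  then on \<open>T\<close>.\<close>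

lemma right_ops_commute:
  assumes "S \<in> right_ops mul" "T \<in> right_ops mul"
  shows "S (T f) - T (S f) \<in> left_annihilator mul"
  using assms
proof (induction arbitrary: f rule: right_ops.induct)
  case ident
  then show ?case by (simp add: left_annihilator_0)
next
  case (right y)
  from right show ?case
  proof (induction arbitrary: f rule: right_ops.induct)
    case (right z)
    show ?case using right_commutative by (simp add: left_annihilator_def ml.diff)
  next
    case (add S T)
    from left_annihilator_add[OF add.IH] show ?case by (simp add: ml.add algebra_simps)
  next
    case (diff S T)
    from left_annihilator_diff[OF diff.IH] show ?case by (simp add: ml.diff algebra_simps)
  next
    case (comp S T)
    from left_annihilator_add[OF comp.IH(1)[of "T f"]
        right_ops_left_annihilator[OF comp.hyps(1) comp.IH(2)[of f]]]
    show ?case using comp.hyps by (simp add: right_ops_diff)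
  qed (simp add: left_annihilator_0)
next
  case (add S S')
  from left_annihilator_add[OF add.IH[OF add.prems]] show ?case
    using add.prems by (simp add: right_ops_add algebra_simps)
next
  case (diff S S')
  from left_annihilator_diff[OF diff.IH[OF diff.prems]] show ?case
    using diff.prems by (simp add: right_ops_diff algebra_simps)
next
  case (comp S S')
  from left_annihilator_add[OF right_ops_left_annihilator[OF comp.hyps(1) comp.IH(2)[OF comp.prems, of f]]
        comp.IH(1)[OF comp.prems, of "S' f"]]
  show ?case using comp.hyps by (simp add: right_ops_diff)
qed

section \<open>Exchange of operators between arguments of a brace\<close>

text \<open>In the recursion the product vanishes, and each subtracted brace has an entry
  \<open>a \<cdot> c = 0\<close>, which symmetry moves to the front.\<close>

lemma brace_left_annihilator:
  assumes "a \<in> left_annihilator mul"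
  shows "brace mul (a # as) z = 0"
proof -
  have 0: "a \<cdot> u = 0" for u using assms by (simp add: left_annihilator_def)
  have "brace mul l z = 0" if "l \<in> set (act_lists mul a as)" for l
  proof -
    obtain us c vs where "l = us @ a \<cdot> c # vs" using act_lists_memE[OF \<open>l \<in> _\<close>] by metis
    then have "brace mul l z = brace mul (0 # us @ vs) z" by (intro brace_mset) (simp add: 0)
    then show ?thesis by (simp only: brace_hd_0)
  qed
  then have "map (\<lambda>l. brace mul l z) (act_lists mul a as) = map (\<lambda>l. 0) (act_lists mul a as)"
    by simp
  then show ?thesis by (simp add: 0 del: map_eq_conv)
qed

lemma brace_cong_left_annihilator:
  "f - f' \<in> left_annihilator mul \<Longrightarrow> brace mul (f # as) z = brace mul (f' # as) z"
  using brace_left_annihilator[of "f - f'" as z] by (simp add: brace_hd_diff del: brace.simps)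

lemma brace_exchange2:
  assumes "T \<in> right_ops mul"
  shows "brace mul [T f, b] z = brace mul [T b, f] z"
  using assms
proof (induction arbitrary: f b rule: right_ops.induct)
  case ident
  show ?case by (rule brace_swap_hd)
next
  case (right y)
  \<comment> \<open>\<open>brace mul [b, c] z\<close> is the negative of the associator of
    \<open>b\<close>, \<open>c\<close>, \<open>z\<close>, so this is the third identity.\<close>
  have "brace mul [b, f \<cdot> y] z = brace mul [f, b \<cdot> y] z"
    using associator_exchange[of b f y z] unfolding associator_def by (simp add: algebra_simps)
  then show ?case unfolding brace_swap_hd[of "f \<cdot> y"] brace_swap_hd[of "b \<cdot> y"] .
next
  case (add S T)
  then show ?case unfolding brace_hd_add by simp
next
  case (diff S T)
  then show ?case unfolding brace_hd_diff by simp
next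
  case (comp S T)
  have "brace mul [S (T f), b] z = brace mul [S b, T f] z" by (rule comp.IH)
  also have "\<dots> = brace mul [T f, S b] z" by (rule brace_swap_hd)
  also have "\<dots> = brace mul [T (S b), f] z" by (rule comp.IH)
  \<comment> \<open>The two moves reverse the order of the operators, which commute up to an element
    that the brace ignores.\<close>
  also have "\<dots> = brace mul [S (T b), f] z"
    using right_ops_commute[OF comp.hyps(2,1)] by (rule brace_cong_left_annihilator)
  finally show ?case .
qed

text \<open>A further argument \<open>c\<close> is moved to the front and expanded, leaving terms
  with fewer arguments. The commutator of left multiplication by \<open>c\<close> with
  \<open>T\<close> occurs there, so the induction needs arbitrary \<open>T\<close>.\<close>

lemma brace_exchange:
  assumes "T \<in> right_ops mul"
  shows "brace mul (T f # b # cs) z = brace mul (T b # f # cs) z"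
  using assms
proof (induction "length cs" arbitrary: f b cs T)
  case 0
  then show ?case using brace_exchange2 by simp
next
  case (Suc n)
  then obtain c ds where cs: "cs = c # ds" "length ds = n" by (cases cs) auto
  let ?T' = "\<lambda>f. c \<cdot> T f - T (c \<cdot> f)"
  have T': "?T' \<in> right_ops mul" using Suc.prems by (rule right_ops_commutator)
  have *: "brace mul (T f # b # cs) z = c \<cdot> brace mul (T f # b # ds) z
      - (brace mul (?T' f # b # ds) z + brace mul (T (c \<cdot> f) # b # ds) z
         + brace mul (T f # c \<cdot> b # ds) z)
      - (\<Sum>l\<leftarrow>act_lists mul c ds. brace mul (T f # b # l) z)" for f b
  proof -
    have "brace mul (T f # b # cs) z = brace mul (c # T f # b # ds) z"
      by (rule brace_mset) (simp add: cs add_mset_commute)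
    also have "\<dots> = c \<cdot> brace mul (T f # b # ds) z
      - (brace mul (c \<cdot> T f # b # ds) z + brace mul (T f # c \<cdot> b # ds) z)
      - (\<Sum>l\<leftarrow>act_lists mul c ds. brace mul (T f # b # l) z)"
      by (subst brace.simps(2)) (simp add: o_def algebra_simps del: brace.simps)
    also have "c \<cdot> T f = ?T' f + T (c \<cdot> f)" by simp
    finally show ?thesis unfolding brace_hd_add by simp
  qed
  have 1: "brace mul (T f # b # ds) z = brace mul (T b # f # ds) z"
    using Suc.hyps(1) cs Suc.prems by metis
  have 2: "brace mul (?T' f # b # ds) z = brace mul (?T' b # f # ds) z"
    using Suc.hyps(1)[OF _ T'] cs by metis
  \<comment> \<open>The terms of 3 and 4 trade places under the exchange of \<open>f\<close> and
    \<open>b\<close>; the others keep their kind.\<close>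
  have 3: "brace mul (T (c \<cdot> f) # b # ds) z = brace mul (T b # c \<cdot> f # ds) z"
    using Suc.hyps(1) cs Suc.prems by metis
  have 4: "brace mul (T f # c \<cdot> b # ds) z = brace mul (T (c \<cdot> b) # f # ds) z"
    using Suc.hyps(1) cs Suc.prems by metis
  have 5: "(\<Sum>l\<leftarrow>act_lists mul c ds. brace mul (T f # b # l) z) =
      (\<Sum>l\<leftarrow>act_lists mul c ds. brace mul (T b # f # l) z)"
    using Suc.hyps(1)[OF _ Suc.prems] cs
    by (intro arg_cong[where f = sum_list] map_cong refl) (simp only: length_act_lists)
  show ?case unfolding *[of f b] *[of b f] 1 2 3 4 5 by (simp add: algebra_simps del: brace.simps)
qed

end

section \<open>Iterated braces of generators\<close>

text \<open>A step \<open>(y, n)\<close> takes the next \<open>n\<close> letters of \<open>ls\<close> as further arguments of a brace over \<open>g y\<close>;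
  \<^const>\<open>take\<close> silently uses fewer letters if the list is too short.\<close>

primrec brace_chain ::
  "('a::ab_group_add \<Rightarrow> 'a \<Rightarrow> 'a) \<Rightarrow> ('x \<Rightarrow> 'a) \<Rightarrow> 'a \<Rightarrow> 'x list \<Rightarrow> ('x \<times> nat) list \<Rightarrow> 'a" where
  "brace_chain mul g f ls [] = f"
| "brace_chain mul g f ls (t # ts) =
     brace_chain mul g (brace mul (f # map g (take (snd t) ls)) (g (fst t))) (drop (snd t) ls) ts"

text \<open>A pair $(M, (y, n))$ stands for the monomial of the free differential Perm-algebra whose last
  letter is $y^{(n)}$ and whose other letters, which commute, are $x^{(m)}$ for $(x, m) \in M$.\<close>

type_synonym 'x monomial = "('x \<times> nat) multiset \<times> ('x \<times> nat)"

text \<open>The last letter \<open>z\<close> of \<open>f\<close> becomes an inner factor and joins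
  the commuting letters. As \<open>f\<close> is an argument too, \<open>y\<close> gets order
  \<open>Suc (length as)\<close>.\<close>

inductive normal_element ::
  "('a::ab_group_add \<Rightarrow> 'a \<Rightarrow> 'a) \<Rightarrow> ('x \<Rightarrow> 'a) \<Rightarrow> 'a \<Rightarrow> 'x monomial \<Rightarrow> bool" for mul g where
  gen: "normal_element mul g (g x) ({#}, (x, 0))"
| brace: "normal_element mul g f (M, z) \<Longrightarrow>
    normal_element mul g (brace mul (f # map g as) (g y))
      (add_mset z M + mset (map (\<lambda>a. (a, 0)) as), (y, Suc (length as)))"

lemma brace_chain_append:
  "length ls = sum_list (map snd ts) \<Longrightarrow>
    brace_chain mul g f (ls @ ls') (ts @ ts') = brace_chain mul g (brace_chain mul g f ls ts) ls' ts'"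
  by (induction ts arbitrary: f ls) simp_all

text \<open>The last step is kept apart because its letter ends the monomial. Steps have positive
  order in \<open>m\<close>, so order 0 marks the letters \<open>x # ls\<close>.\<close>

lemma normal_element_brace_chain:
  assumes "normal_element mul g f m"
  obtains (gen) x where "f = g x" "m = ({#}, (x, 0))"
  | (chain) x ls ts y n where "length ls = sum_list (map snd ts) + n"
      "f = brace_chain mul g (g x) ls (ts @ [(y, n)])"
      "m = (mset (map (\<lambda>a. (a, 0)) (x # ls)) + mset (map (apsnd Suc) ts), (y, Suc n))"
proof -
  have "(\<exists>x. f = g x \<and> m = ({#}, (x, 0))) \<or>
    (\<exists>x ls ts y n. length ls = sum_list (map snd ts) + n \<and>
      f = brace_chain mul g (g x) ls (ts @ [(y, n)]) \<and>
      m = (mset (map (\<lambda>a. (a, 0)) (x # ls)) + mset (map (apsnd Suc) ts), (y, Suc n)))"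
    using assms
  proof (induction rule: normal_element.induct)
    case (brace f M z as y)
    from brace.IH show ?case
    proof (elim disjE exE conjE)
      fix x assume "f = g x" "(M, z) = ({#}, x, 0)"
      then show ?thesis
        by - (rule disjI2, rule exI[of _ x], rule exI[of _ as], rule exI[of _ "[]"], rule exI[of _ y],
            simp)
    next
      fix x ls ts y' n
      assume len: "length ls = sum_list (map snd ts) + n"
        and f: "f = brace_chain mul g (g x) ls (ts @ [(y', n)])"
        and M: "(M, z) = (mset (map (\<lambda>a. (a, 0)) (x # ls)) + mset (map (apsnd Suc) ts), y', Suc n)"
      have "brace mul (f # map g as) (g y) =
          brace_chain mul g (g x) (ls @ as) ((ts @ [(y', n)]) @ [(y, length as)])"
        using len by (subst brace_chain_append) (simp_all add: f)
      then show ?thesis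
        using len M
        by - (rule disjI2, rule exI[of _ x], rule exI[of _ "ls @ as"], rule exI[of _ "ts @ [(y', n)]"],
            rule exI[of _ y], simp del: brace.simps)
    qed
  qed simp
  then show thesis using gen chain by blast
qed

section \<open>Uniqueness of the normal element over a monomial\<close>

context sls_algebra
begin

text \<open>Steps before the one that takes \<open>b\<close> are absorbed into \<open>T\<close>; at
  that step \<open>brace_exchange\<close> trades \<open>g x\<close> for \<open>g b\<close>.\<close>

lemma brace_chain_swap_head:
  assumes "T \<in> right_ops mul" "length us + length vs + 1 = sum_list (map snd ts)"
  shows "brace_chain mul g (T (g x)) (us @ b # vs) ts = brace_chain mul g (T (g b)) (us @ x # vs) ts"
  using assms
proof (induction ts arbitrary: T us)
  case (Cons t ts)
  obtain y m where t: "t = (y, m)" by force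
  show ?case
  proof (cases "length us < m")
    case True
    \<comment> \<open>This step takes \<open>b\<close> and then \<open>k\<close> more
      letters.\<close>
    then obtain k where m: "m = Suc (length us + k)" using less_imp_Suc_add by auto
    have "brace mul (T (g x) # map g us @ g b # map g (take k vs)) (g y) =
        brace mul (T (g x) # g b # map g us @ map g (take k vs)) (g y)"
      by (rule brace_mset) simp
    also have "\<dots> = brace mul (T (g b) # g x # map g us @ map g (take k vs)) (g y)"
      by (rule brace_exchange[OF Cons.prems(1)])
    also have "\<dots> = brace mul (T (g b) # map g us @ g x # map g (take k vs)) (g y)"
      by (rule brace_mset) simp
    finally show ?thesis by (simp add: t m del: brace.simps)
  next
    case False
    have "(\<lambda>f. brace mul (T f # map g (take m us)) (g y)) \<in> right_ops mul"
      by (rule right_ops.comp[OF brace_right_op Cons.prems(1)])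
    from Cons.IH[OF this, of "drop m us"] show ?thesis
      using Cons.prems(2) False by (simp add: t del: brace.simps)
  qed
qed simp

lemma brace_chain_letters:
  assumes len: "length ls = sum_list (map snd ts)" and eq: "mset (x # ls) = mset (x' # ls')"
  shows "brace_chain mul g (g x) ls ts = brace_chain mul g (g x') ls' ts"
proof -
  let ?F = "\<lambda>l. brace_chain mul g (g (hd l)) (tl l) ts"
  note swap = brace_chain_swap_head[OF right_ops.ident]
  have "?F (us @ a # b # vs) = ?F (us @ b # a # vs)"
    if "length us + length vs + 2 = length (x # ls)" for us a b vs
  proof (cases us)
    case Nil
    then show ?thesis using that len swap[of "[]" vs ts g a b] by simp
  next
    case (Cons c us')
    \<comment> \<open>Away from the head, the swap of \<open>a\<close> and \<open>b\<close> is a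
      product of three exchanges with the head: \<open>c\<close> with \<open>a\<close>,
      \<open>a\<close> with \<open>b\<close>, \<open>b\<close> with \<open>c\<close>.\<close>
    then show ?thesis
      using that len swap[of us' "b # vs" ts g c a] swap[of "us' @ [c]" vs ts g a b]
        swap[of us' "a # vs" ts g b c]
      by simp
  qed
  from adjacent_swaps_invariant[where F = ?F, OF this eq] show ?thesis by simp
qed

lemma brace_chain_cong_left_annihilator:
  "f - f' \<in> left_annihilator mul \<Longrightarrow> ts \<noteq> [] \<Longrightarrow>
    brace_chain mul g f ls ts = brace_chain mul g f' ls ts"
  by (cases ts) (simp_all add: brace_cong_left_annihilator del: brace.simps)

text \<open>Neighbouring steps commute modulo the left annihilator, and a later step, at the latest
  \<open>(y, n)\<close>, absorbs the difference. \<open>brace_chain_letters\<close> then restores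
  the order of the letters.\<close>

lemma brace_chain_steps:
  assumes eq: "mset ts = mset ts'" and len: "length ls = sum_list (map snd ts) + n"
  shows "brace_chain mul g (g x) ls (ts @ [(y, n)]) = brace_chain mul g (g x) ls (ts' @ [(y, n)])"
proof -
  \<comment> \<open>The default 0 makes swaps trivial for step lists whose total does not fit
    \<open>ls\<close>.\<close>
  let ?F = "\<lambda>ts. if length ls = sum_list (map snd ts) + n
    then brace_chain mul g (g x) ls (ts @ [(y, n)]) else 0"
  have "?F (us @ a # b # vs) = ?F (us @ b # a # vs)" for us a b vs
  proof (cases "length ls = sum_list (map snd (us @ a # b # vs)) + n")
    case True
    obtain p i q j where ab: "a = (p, i)" "b = (q, j)" by (metis surj_pair)
    \<comment> \<open>\<open>l0\<close>, \<open>l1\<close>, \<open>l2\<close>, \<open>r\<close> are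
      the letters taken by \<open>us\<close>, \<open>a\<close>, \<open>b\<close> and the remaining
      steps.\<close>
    define l0 where "l0 = take (sum_list (map snd us)) ls"
    define l1 where "l1 = take i (drop (length l0) ls)"
    define l2 where "l2 = take j (drop (length l0 + i) ls)"
    define r where "r = drop (length l0 + i + j) ls"
    have len0: "length l0 = sum_list (map snd us)" "length l1 = i" "length l2 = j"
      using True by (simp_all add: l0_def l1_def l2_def ab)
    have ls: "ls = l0 @ l1 @ l2 @ r"
      unfolding l0_def l1_def l2_def r_def
      using True by (simp add: ab add.commute append_take_drop_id flip: drop_drop)
    let ?f = "brace_chain mul g (g x) l0 us" and ?ts = "vs @ [(y, n)]"
    let ?A = "\<lambda>f. brace mul (f # map g l1) (g p)" and ?B = "\<lambda>f. brace mul (f # map g l2) (g q)"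
    have "brace_chain mul g (g x) ls (us @ a # b # ?ts) = brace_chain mul g (?B (?A ?f)) r ?ts"
      by (simp add: ls ab brace_chain_append len0 del: brace.simps)
    also have "\<dots> = brace_chain mul g (?A (?B ?f)) r ?ts"
      by (intro brace_chain_cong_left_annihilator right_ops_commute brace_right_op) simp
    also have "\<dots> = brace_chain mul g (g x) (l0 @ l2 @ l1 @ r) (us @ b # a # ?ts)"
      by (simp add: ab brace_chain_append len0 del: brace.simps)
    also have "\<dots> = brace_chain mul g (g x) ls (us @ b # a # ?ts)"
      using True by (intro brace_chain_letters) (simp_all add: ls)
    finally show ?thesis using True by (simp add: add.left_commute)
  qed (simp add: add.left_commute)
  from adjacent_swaps_invariant[where F = ?F, OF this eq] have "?F ts = ?F ts'" .
  moreover have "sum_list (map snd ts) = sum_list (map snd ts')"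
    using eq by (metis mset_map sum_mset_sum_list)
  ultimately show ?thesis using len by simp
qed

text \<open>The monomial determines the chain up to reordering: order 0 gives \<open>x # ls\<close>,
  positive order gives \<open>ts\<close>, the last letter gives \<open>(y, n)\<close>. A last letter
  of order 0 occurs only for generators.\<close>

lemma normal_element_unique:
  assumes f: "normal_element mul g f m" and f': "normal_element mul g f' m"
  shows "f = f'"
  using f
proof (cases rule: normal_element_brace_chain)
  case (gen x)
  from f' gen show ?thesis by (cases rule: normal_element_brace_chain) auto
next
  case (chain x ls ts y n)
  note 1 = this
  from f' show ?thesis
  proof (cases rule: normal_element_brace_chain)
    case (chain x' ls' ts' y' n')
    let ?M = "\<lambda>x ls ts. mset (map (\<lambda>a. (a, 0::nat)) (x # ls)) + mset (map (apsnd Suc) ts)"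
    have M: "?M x ls ts = ?M x' ls' ts'" and y: "y' = y" "n' = n"
      using 1 chain by auto
    have low: "image_mset fst (filter_mset (\<lambda>z. snd z = 0) (?M x ls ts)) = mset (x # ls)" for x ls ts
      by (simp add: filter_mset_image_mset multiset.map_comp o_def)
    have high: "image_mset (apsnd (\<lambda>n. n - 1)) (filter_mset (\<lambda>z. snd z \<noteq> 0) (?M x ls ts)) = mset ts"
      for x ls ts
      by (simp add: filter_mset_image_mset multiset.map_comp o_def apsnd_def map_prod_def case_prod_unfold)
    have "mset (x # ls) = mset (x' # ls')" using low[of x ls ts] low[of x' ls' ts'] M by metis
    moreover have "mset ts = mset ts'" using high[of x ls ts] high[of x' ls' ts'] M by metis
    ultimately show ?thesis
      using 1(1,2) chain(2) y brace_chain_steps[of ts ts' ls n g x y]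
        brace_chain_letters[of ls "ts @ [(y, n)]" x x' ls' g]
        brace_chain_letters[of ls "ts' @ [(y, n)]" x x' ls' g]
      by (metis (no_types, lifting) mset_map sum_mset_sum_list map_append sum_list.append
          list.simps(8,9) snd_conv sum_list_simps add_0_right)
  qed (use 1 in auto)
qed

end

section \<open>Normal elements span a subalgebra\<close>

definition normal_elements :: "('a::ab_group_add \<Rightarrow> 'a \<Rightarrow> 'a) \<Rightarrow> ('x \<Rightarrow> 'a) \<Rightarrow> 'a set" where
  "normal_elements mul g = {f. \<exists>m. normal_element mul g f m}"

lemma normal_elements_gen: "g x \<in> normal_elements mul g"
  unfolding normal_elements_def by (auto intro: normal_element.gen)

lemma normal_elements_brace:
  "f \<in> normal_elements mul g \<Longrightarrow> brace mul (f # map g as) (g y) \<in> normal_elements mul g"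
  unfolding normal_elements_def by (auto simp del: brace.simps intro: normal_element.brace)

lemma (in vector_space) linear_span_into_span:
  assumes "Vector_Spaces.linear scale scale T" "\<And>c. c \<in> C \<Longrightarrow> T c \<in> span C" "v \<in> span C"
  shows "T v \<in> span C"
proof -
  interpret T: Vector_Spaces.linear scale scale T by fact
  have "subspace {v. T v \<in> span C}"
    by (rule subspaceI) (auto simp: T.zero T.add T.scale span_zero span_add span_scale)
  from span_induct[OF assms(3), of "\<lambda>v. T v \<in> span C", OF this assms(2)] show ?thesis .
qed

lemma (in vector_space) span_sum_list:
  "(\<And>x. x \<in> set xs \<Longrightarrow> h x \<in> span C) \<Longrightarrow> (\<Sum>x\<leftarrow>xs. h x) \<in> span C"
  by (induction xs) (auto simp: span_zero intro!: span_add)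

context sls_algebra
begin

lemma normal_elements_induct [consumes 1, case_names gen brace]:
  assumes "f \<in> normal_elements mul g"
    and "\<And>x. P (g x)"
    and "\<And>f as y. f \<in> normal_elements mul g \<Longrightarrow> P f \<Longrightarrow> P (brace mul (f # map g as) (g y))"
  shows "P f"
proof -
  obtain m where "normal_element mul g f m" using assms(1) by (auto simp: normal_elements_def)
  then show ?thesis
  proof (induction rule: normal_element.induct)
    case (gen x)
    show ?case by (rule assms(2))
  next
    case (brace f M z as y)
    then have "f \<in> normal_elements mul g" unfolding normal_elements_def by blast
    then show ?case using brace.IH by (rule assms(3))
  qed
qed

text \<open>\<open>T\<close> is the composite of the braces around the innermost generator; in this
  form \<open>brace_exchange\<close> can move it to another argument.\<close>

lemma normal_elements_right_op:
  assumes "f \<in> normal_elements mul g"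
  obtains T x where "T \<in> right_ops mul" "f = T (g x)"
    "\<And>h. h \<in> normal_elements mul g \<Longrightarrow> T h \<in> normal_elements mul g"
proof -
  from assms have "\<exists>T\<in>right_ops mul. \<exists>x. f = T (g x) \<and>
      (\<forall>h\<in>normal_elements mul g. T h \<in> normal_elements mul g)"
  proof (induction rule: normal_elements_induct)
    case (gen x)
    show ?case by (rule bexI[OF _ right_ops.ident]) auto
  next
    case (brace f as y)
    then obtain T x where T: "T \<in> right_ops mul" "f = T (g x)"
      "\<forall>h\<in>normal_elements mul g. T h \<in> normal_elements mul g" by blast
    show ?case
      by (rule bexI[OF _ right_ops.comp[OF brace_right_op[of "map g as" "g y"] T(1)]])
         (use T in \<open>auto intro: normal_elements_brace simp del: brace.simps\<close>)
  qed
  then show thesis using that by blast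
qed

text \<open>By the exchange property the right operators producing the arguments can all be moved to
  the first one.\<close>

lemma normal_elements_brace_list:
  assumes "f \<in> normal_elements mul g" "set fs \<subseteq> normal_elements mul g"
  shows "brace mul (f # fs @ map g as) (g y) \<in> normal_elements mul g"
  using assms
proof (induction fs arbitrary: f as)
  case Nil
  then show ?case by (simp add: normal_elements_brace del: brace.simps)
next
  case (Cons f2 fs)
  then obtain T x where T: "T \<in> right_ops mul" "f2 = T (g x)"
    "\<And>h. h \<in> normal_elements mul g \<Longrightarrow> T h \<in> normal_elements mul g"
    using normal_elements_right_op[of f2] by (metis insert_subset list.set(2))
  have "brace mul (f # (f2 # fs) @ map g as) (g y) = brace mul (f2 # f # fs @ map g as) (g y)"
    by (rule brace_mset) simp
  also have "\<dots> = brace mul (T f # g x # fs @ map g as) (g y)"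
    unfolding T(2) by (rule brace_exchange[OF T(1)])
  also have "\<dots> = brace mul (T f # fs @ map g (x # as)) (g y)"
    by (rule brace_mset) simp
  finally show ?case using Cons.IH[of "T f" "x # as"] T(3) Cons.prems by simp
qed

text \<open>By bilinearity both factors may be normal; induction on the second one reads the
  recursion for \<open>brace\<close> backwards, as a formula for the product.\<close>

lemma span_normal_elements_mul:
  assumes "p \<in> span (normal_elements mul g)" "q \<in> span (normal_elements mul g)"
  shows "p \<cdot> q \<in> span (normal_elements mul g)"
proof -
  let ?N = "normal_elements mul g"
  have "f \<cdot> h \<in> span ?N" if f: "f \<in> ?N" and "h \<in> ?N" for f h
    using that(2)
  proof (induction rule: normal_elements_induct)
    case (gen x)
    show ?case using normal_elements_brace[OF f, of "[]" x] by (simp add: span_base)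
  next
    case (brace h as y)
    let ?B = "\<lambda>v. brace mul (v # map g as) (g y)"
    have "f \<cdot> ?B h = brace mul (f # h # map g as) (g y) + ?B (f \<cdot> h)
        + (\<Sum>l\<leftarrow>act_lists mul f (map g as). brace mul (h # l) (g y))"
      by (subst brace.simps(2)[of _ f]) (simp add: o_def algebra_simps del: brace.simps(2))
    moreover have "brace mul (f # h # map g as) (g y) \<in> span ?N"
      using normal_elements_brace_list[OF f, of "[h]"] brace.hyps by (simp add: span_base del: brace.simps)
    moreover have "?B (f \<cdot> h) \<in> span ?N"
      by (rule linear_span_into_span[OF linear_right_ops[OF brace_right_op] _ brace.IH])
         (intro span_base normal_elements_brace)
    moreover have "brace mul (h # l) (g y) \<in> span ?N" if l: "l \<in> set (act_lists mul f (map g as))" for l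
    proof -
      obtain us c vs where l: "map g as = us @ c # vs" "l = us @ f \<cdot> c # vs"
        using act_lists_memE[OF l] by metis
      then obtain us' c' vs' where c: "us = map g us'" "c = g c'" "vs = map g vs'"
        by (auto simp: map_eq_append_conv map_eq_Cons_conv)
      \<comment> \<open>A product with a generator is a brace with one argument.\<close>
      have "f \<cdot> c \<in> ?N" using normal_elements_brace[OF f, of "[]" c'] by (simp add: c)
      from normal_elements_brace_list[OF brace.hyps, of "[f \<cdot> c]" "us' @ vs'" y] this
      have "brace mul (h # [f \<cdot> c] @ map g (us' @ vs')) (g y) \<in> ?N" by simp
      also have "brace mul (h # [f \<cdot> c] @ map g (us' @ vs')) (g y) = brace mul (h # l) (g y)"
        by (rule brace_mset) (simp add: l c)
      finally show ?thesis by (rule span_base)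
    qed
    then have "(\<Sum>l\<leftarrow>act_lists mul f (map g as). brace mul (h # l) (g y)) \<in> span ?N"
      by (rule span_sum_list)
    ultimately show ?case by (simp only: span_add)
  qed
  then have "f \<cdot> q \<in> span ?N" if "f \<in> ?N" for f
    using linear_span_into_span[OF linear_mul_right _ assms(2)] that by blast
  then show ?thesis using linear_span_into_span[OF linear_mul_left _ assms(1)] by blast
qed

end

lemma subalgebra_free_sls_UNIV:
  fixes S :: "('x, 'k::field) free_sls set"
  assumes "subalgebra sls_scale sls_mul S" "range sls_gen \<subseteq> S"
  shows "S = UNIV"
proof -
  interpret A: nonassoc_algebra "sls_scale :: 'k \<Rightarrow> ('x, 'k) free_sls \<Rightarrow> _" sls_mul
    by (rule nonassoc_algebra_sls)
  have S: "A.subspace S" "\<And>x y. x \<in> S \<Longrightarrow> y \<in> S \<Longrightarrow> sls_mul x y \<in> S"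
    using assms(1) by (auto simp: subalgebra_def)
  have basis: "abs_free_sls (Poly_Mapping.single w 1) \<in> S" for w
  proof (induction w)
    case (Letter x)
    then show ?case using assms(2) by (auto simp flip: sls_gen.abs_eq)
  next
    case (Prod u v)
    have "Poly_Mapping.single (Prod u v) 1 =
        word_mul (Poly_Mapping.single u 1) (Poly_Mapping.single v (1 :: 'k))"
      by (simp add: word_mul_def lin_ext_single[OF vector_space_fscale])
    then show ?case using S(2)[OF Prod.IH] by (simp flip: sls_mul.abs_eq)
  qed
  have lin: "Vector_Spaces.linear fscale (sls_scale :: 'k \<Rightarrow> ('x, 'k) free_sls \<Rightarrow> _) abs_free_sls"
    by (rule vs_linearI[OF vector_space_fscale A.vector_space_axioms])
       (simp_all flip: plus_free_sls.abs_eq sls_scale.abs_eq)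
  have "abs_free_sls p \<in> S" for p
  proof -
    have "abs_free_sls p = lin_ext sls_scale (\<lambda>u. abs_free_sls (Poly_Mapping.single u 1)) p"
      using linear_lin_ext_comp[OF lin, of "\<lambda>u. Poly_Mapping.single u 1" p] by simp
    then show ?thesis
      unfolding lin_ext_def
      using basis by (simp add: A.subspace_sum[OF S(1)] A.subspace_scale[OF S(1)])
  qed
  then show ?thesis by (metis Quotient_abs_rep[OF Quotient_free_sls] UNIV_eq_I)
qed

lemma span_normal_elements_sls:
  "module.span sls_scale (normal_elements sls_mul (sls_gen :: 'x \<Rightarrow> ('x, 'k::field) free_sls)) = UNIV"
proof -
  interpret S: sls_algebra "sls_scale :: 'k \<Rightarrow> ('x, 'k) free_sls \<Rightarrow> _" sls_mul
    by (rule sls_algebra_free_sls)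
  show ?thesis
    using normal_elements_gen[of "sls_gen :: 'x \<Rightarrow> ('x, 'k) free_sls"]
    by (intro subalgebra_free_sls_UNIV)
       (auto simp: subalgebra_def intro: S.span_normal_elements_mul S.span_base)
qed

section \<open>Differential Perm-algebras\<close>

context diff_perm_algebra
begin

sublocale d: Vector_Spaces.linear scale scale d by (rule linear_d)

lemma mul_left_commute: "x \<cdot> (y \<cdot> z) = y \<cdot> (x \<cdot> z)"
  using perm_algebra.perm[OF perm_algebra_axioms, of x y z] by (simp add: mul_assoc)

lemma sls_algebra_circ: "sls_algebra scale (\<lambda>f h. f \<cdot> d h)"
proof -
  have "nonassoc_algebra scale (\<lambda>f h. f \<cdot> d h)"
    by unfold_locales (simp_all add: d.add d.scale mr.add ml.add mr.scale ml.scale)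
  then interpret C: nonassoc_algebra scale "\<lambda>f h. f \<cdot> d h" .
  \<comment> \<open>The first and third identities follow from this formula, since all factors but
    the last commute.\<close>
  have assoc: "associator (\<lambda>f h. f \<cdot> d h) x y z = - (x \<cdot> (y \<cdot> d (d z)))" for x y z
    by (simp add: associator_def leibniz mr.add mul_assoc)
  show ?thesis
    by unfold_locales (simp_all add: assoc mul_assoc mul_left_commute)
qed

text \<open>Where the Leibniz rule puts \<open>d\<close> on an entry \<open>c\<close>, the factor
  \<open>a\<close> moves next to it and forms \<open>a \<cdot> d c\<close>.\<close>

lemma mul_der_foldr:
  "a \<cdot> d (foldr mul as w) =
    (\<Sum>l\<leftarrow>act_lists (\<lambda>f h. f \<cdot> d h) a as. foldr mul l w) + a \<cdot> foldr mul as (d w)"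
proof (induction as)
  case (Cons c as)
  have *: "c \<cdot> (\<Sum>x\<leftarrow>xs. h x) = (\<Sum>x\<leftarrow>xs. c \<cdot> h x)" for h and xs :: "'b list list"
    by (induction xs) (simp_all add: mr.add mr.zero)
  have "a \<cdot> d (foldr mul (c # as) w) = (a \<cdot> d c) \<cdot> foldr mul as w + c \<cdot> (a \<cdot> d (foldr mul as w))"
    by (simp add: leibniz mr.add mul_assoc mul_left_commute[of c])
  then show ?case
    unfolding Cons.IH mr.add by (simp add: * o_def mul_left_commute[of c] add.assoc)
qed simp

text \<open>By \<open>mul_der_foldr\<close> the sum subtracted in the recursion cancels the terms in
  which an argument is differentiated.\<close>

lemma brace_circ: "brace (\<lambda>f h. f \<cdot> d h) as z = foldr mul as ((d ^^ length as) z)"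
proof (induction "length as" arbitrary: as)
  case (Suc n)
  then obtain a bs where as: "as = a # bs" "length bs = n" by (cases as) auto
  have "brace (\<lambda>f h. f \<cdot> d h) bs z = foldr mul bs ((d ^^ n) z)" using Suc.hyps(1) as by blast
  moreover have "(\<Sum>l\<leftarrow>act_lists (\<lambda>f h. f \<cdot> d h) a bs. brace (\<lambda>f h. f \<cdot> d h) l z) =
      (\<Sum>l\<leftarrow>act_lists (\<lambda>f h. f \<cdot> d h) a bs. foldr mul l ((d ^^ n) z))"
    using Suc.hyps(1) as
    by (intro arg_cong[where f = sum_list] map_cong refl) (metis length_act_lists)
  ultimately show ?case by (simp add: as mul_der_foldr)
qed simp

end

section \<open>The differential Perm-algebra spanned by monomials\<close>

definition monomial_mul ::
  "('x monomial \<Rightarrow>\<^sub>0 'k::field) \<Rightarrow> ('x monomial \<Rightarrow>\<^sub>0 'k) \<Rightarrow> ('x monomial \<Rightarrow>\<^sub>0 'k)" where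
  "monomial_mul p q =
     lin_ext fscale (\<lambda>u. lin_ext fscale
       (\<lambda>v. Poly_Mapping.single (add_mset (snd u) (fst u) + fst v, snd v) 1) q) p"

definition monomial_der :: "('x monomial \<Rightarrow>\<^sub>0 'k::field) \<Rightarrow> ('x monomial \<Rightarrow>\<^sub>0 'k)" where
  "monomial_der =
     lin_ext fscale (\<lambda>(M, z).
       (\<Sum>m\<in>#M. Poly_Mapping.single (add_mset (apsnd Suc m) (M - {#m#}), z) 1)
       + Poly_Mapping.single (M, apsnd Suc z) 1)"

lemma monomial_mul_single:
  "monomial_mul (Poly_Mapping.single (M, y) 1) (Poly_Mapping.single (N, z) (1 :: 'k::field)) =
    Poly_Mapping.single (add_mset y M + N, z) 1"
  by (simp add: monomial_mul_def lin_ext_single[OF vector_space_fscale])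

lemma monomial_der_single:
  "monomial_der (Poly_Mapping.single (M, z) (1 :: 'k::field)) =
    (\<Sum>m\<in>#M. Poly_Mapping.single (add_mset (apsnd Suc m) (M - {#m#}), z) 1)
    + Poly_Mapping.single (M, apsnd Suc z) 1"
  by (simp add: monomial_der_def lin_ext_single[OF vector_space_fscale])

lemma poly_mapping_basis_induct [case_names zero add scale single]:
  fixes p :: "'b \<Rightarrow>\<^sub>0 'k::field"
  assumes "P 0" "\<And>p q. P p \<Longrightarrow> P q \<Longrightarrow> P (p + q)" "\<And>c p. P p \<Longrightarrow> P (fscale c p)"
    and "\<And>u. P (Poly_Mapping.single u 1)"
  shows "P p"
proof -
  have "P (\<Sum>u\<in>A. fscale (c u) (Poly_Mapping.single u 1))" if "finite A" for A and c :: "'b \<Rightarrow> 'k"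
    using that by (induction A rule: finite_induct) (simp_all add: assms)
  from this[of "Poly_Mapping.keys p" "Poly_Mapping.lookup p"] show ?thesis
    using lin_ext_singles[of p] by (simp add: lin_ext_def)
qed

interpretation monomial: nonassoc_algebra fscale monomial_mul
proof -
  show "nonassoc_algebra fscale (monomial_mul :: ('x monomial \<Rightarrow>\<^sub>0 'k::field) \<Rightarrow> _)"
    unfolding monomial_mul_def
    by (intro nonassoc_algebra.intro nonassoc_algebra_axioms.intro
        linear_lin_ext linear_lin_ext_pointwise vector_space_fscale)
qed

interpretation monomial_der: Vector_Spaces.linear fscale fscale monomial_der
  unfolding monomial_der_def by (rule linear_lin_ext[OF vector_space_fscale])

text \<open>Differentiating \<open>y\<close> or a letter of \<open>M\<close> gives the first
  summand, differentiating \<open>z\<close> or a letter of \<open>N\<close> the second.\<close>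

lemma monomial_der_leibniz_single:
  fixes u v :: "'x monomial"
  defines "e \<equiv> \<lambda>u :: 'x monomial. Poly_Mapping.single u (1 :: 'k::field)"
  shows "monomial_der (monomial_mul (e u) (e v)) =
    monomial_mul (monomial_der (e u)) (e v) + monomial_mul (e u) (monomial_der (e v))"
proof -
  obtain M y where u: "u = (M, y)" by (rule prod.exhaust)
  obtain N z where v: "v = (N, z)" by (rule prod.exhaust)
  note uv = u v
  let ?D = "\<lambda>K L. \<Sum>m\<in>#L. e (add_mset (apsnd Suc m) (K + (L - {#m#})), z)"
  have suml: "monomial_mul (\<Sum>m\<in>#L. h m) q = (\<Sum>m\<in>#L. monomial_mul (h m) q)"
    for h :: "'x \<times> nat \<Rightarrow> 'x monomial \<Rightarrow>\<^sub>0 'k" and L q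
    by (induction L) (simp_all add: monomial.ml.add monomial.ml.zero)
  have sumr: "monomial_mul q (\<Sum>m\<in>#L. h m) = (\<Sum>m\<in>#L. monomial_mul q (h m))"
    for h :: "'x \<times> nat \<Rightarrow> 'x monomial \<Rightarrow>\<^sub>0 'k" and L q
    by (induction L) (simp_all add: monomial.mr.add monomial.mr.zero)
  have diff: "(\<Sum>m\<in>#L. e (add_mset (apsnd Suc m) (add_mset y M + N - {#m#}), z)) = ?D K L"
    if "add_mset y M + N = K + L" for K L
    unfolding that
    by (intro arg_cong[where f = sum_mset] image_mset_cong) (simp only: diff_union_single_conv)
  have "monomial_der (monomial_mul (e u) (e v)) =
      (\<Sum>m\<in>#add_mset y M + N. e (add_mset (apsnd Suc m) (add_mset y M + N - {#m#}), z))
      + e (add_mset y M + N, apsnd Suc z)"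
    unfolding e_def uv monomial_mul_single monomial_der_single ..
  also have "\<dots> = (\<Sum>m\<in>#M. e (add_mset (apsnd Suc m) (add_mset y M + N - {#m#}), z))
      + e (add_mset (apsnd Suc y) (M + N), z)
      + (\<Sum>m\<in>#N. e (add_mset (apsnd Suc m) (add_mset y M + N - {#m#}), z))
      + e (add_mset y M + N, apsnd Suc z)"
    by (simp add: ac_simps)
  also have "\<dots> = ?D (add_mset y N) M + e (add_mset (apsnd Suc y) (M + N), z)
      + ?D (add_mset y M) N + e (add_mset y M + N, apsnd Suc z)"
    using diff[of "add_mset y N" M] diff[of "add_mset y M" N]
    by (simp only: add.commute[of M N] union_mset_add_mset_left)
  also have "\<dots> = monomial_mul (monomial_der (e u)) (e v) + monomial_mul (e u) (monomial_der (e v))"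
    unfolding e_def uv monomial_der_single monomial.ml.add monomial.mr.add suml sumr monomial_mul_single
    by (simp only: union_mset_add_mset_left union_mset_add_mset_right ac_simps add_mset_commute)
  finally show ?thesis .
qed

text \<open>This provides a target for the universal property in which monomials are independent.
  The laws are multilinear and are checked on basis vectors.\<close>

lemma diff_perm_algebra_monomial:
  "diff_perm_algebra fscale (monomial_mul :: ('x monomial \<Rightarrow>\<^sub>0 'k::field) \<Rightarrow> _) monomial_der"
proof
  note lin = monomial.ml.add monomial.mr.add monomial.ml.scale monomial.mr.scale
    monomial.ml.zero monomial.mr.zero monomial_der.add monomial_der.scale monomial_der.zero
    monomial.scale_right_distrib
  fix x y z :: "'x monomial \<Rightarrow>\<^sub>0 'k" and c
  show "monomial_mul (monomial_mul x y) z = monomial_mul x (monomial_mul y z)"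
  proof (induction x rule: poly_mapping_basis_induct)
    case (single u)
    show ?case
    proof (induction y rule: poly_mapping_basis_induct)
      case (single v)
      show ?case
      proof (induction z rule: poly_mapping_basis_induct)
        case (single w)
        show ?case by (cases u; cases v; cases w) (simp add: monomial_mul_single ac_simps add_mset_commute)
      qed (simp_all add: lin)
    qed (simp_all add: lin)
  qed (simp_all add: lin)
  show "monomial_mul (monomial_mul x y) z = monomial_mul (monomial_mul y x) z"
  proof (induction x rule: poly_mapping_basis_induct)
    case (single u)
    show ?case
    proof (induction y rule: poly_mapping_basis_induct)
      case (single v)
      show ?case
      proof (induction z rule: poly_mapping_basis_induct)
        case (single w)
        show ?case by (cases u; cases v; cases w) (simp add: monomial_mul_single ac_simps add_mset_commute)
      qed (simp_all add: lin)
    qed (simp_all add: lin)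
  qed (simp_all add: lin)
  show "monomial_der (monomial_mul x y) =
      monomial_mul (monomial_der x) y + monomial_mul x (monomial_der y)"
  proof (induction x rule: poly_mapping_basis_induct)
    case (single u)
    show ?case
    proof (induction y rule: poly_mapping_basis_induct)
      case (single v)
      show ?case by (rule monomial_der_leibniz_single)
    qed (simp_all add: lin ac_simps)
  qed (simp_all add: lin ac_simps)
qed

section \<open>Injectivity of the canonical homomorphism\<close>

lemma hom_act_lists:
  assumes "\<And>x y. \<phi> (mul x y) = mul' (\<phi> x) (\<phi> y)"
  shows "act_lists mul' (\<phi> a) (map \<phi> as) = map (map \<phi>) (act_lists mul a as)"
  by (induction as) (simp_all add: assms)

lemma hom_brace:
  assumes add: "\<And>x y. \<phi> (x + y) = \<phi> x + \<phi> y"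
    and mul: "\<And>x y. \<phi> (mul x y) = mul' (\<phi> x) (\<phi> y)"
  shows "\<phi> (brace mul as z) = brace mul' (map \<phi> as) (\<phi> z)"
proof (induction "length as" arbitrary: as)
  case (Suc n)
  interpret \<phi>: additive \<phi> by unfold_locales (rule add)
  obtain a bs where as: "as = a # bs" "length bs = n" using Suc.hyps(2) by (cases as) auto
  have sum: "\<phi> (\<Sum>x\<leftarrow>xs. h x) = (\<Sum>x\<leftarrow>xs. \<phi> (h x))" for h and xs :: "'a list list"
    by (induction xs) (simp_all add: \<phi>.add \<phi>.zero)
  have "(\<Sum>l\<leftarrow>act_lists mul a bs. \<phi> (brace mul l z)) =
      (\<Sum>l\<leftarrow>act_lists mul a bs. brace mul' (map \<phi> l) (\<phi> z))"
    using Suc.hyps(1) as by (intro arg_cong[where f = sum_list] map_cong refl) (metis length_act_lists)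
  then show ?case
    using Suc.hyps(1)[of bs] as by (simp add: \<phi>.diff mul sum hom_act_lists[where \<phi> = \<phi> and mul = mul, OF mul] o_def)
qed simp

lemma monomial_der_funpow:
  "(monomial_der ^^ n) (Poly_Mapping.single ({#}, (y, m)) (1 :: 'k::field)) =
    Poly_Mapping.single ({#}, (y, m + n)) 1"
  by (induction n) (simp_all add: monomial_der_single)

lemma foldr_monomial_mul_letters:
  "foldr monomial_mul (map (\<lambda>a. Poly_Mapping.single ({#}, z a) 1) as)
      (Poly_Mapping.single (M, w) (1 :: 'k::field)) =
    Poly_Mapping.single (M + mset (map z as), w) 1"
  by (induction as) (simp_all add: monomial_mul_single)

text \<open>\<open>hom_brace\<close> and \<open>brace_circ\<close> turn each brace into a product of
  its arguments with a derivative of a letter, whose monomial the index \<open>m\<close>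
  records.\<close>

lemma normal_element_hom_monomial:
  fixes \<phi> :: "'a::ab_group_add \<Rightarrow> 'x monomial \<Rightarrow>\<^sub>0 'k::field"
  assumes add: "\<And>x y. \<phi> (x + y) = \<phi> x + \<phi> y"
    and mul: "\<And>x y. \<phi> (mul x y) = monomial_mul (\<phi> x) (monomial_der (\<phi> y))"
    and gen: "\<And>x. \<phi> (g x) = Poly_Mapping.single ({#}, (x, 0)) 1"
    and "normal_element mul g f m"
  shows "\<phi> f = Poly_Mapping.single m 1"
proof -
  interpret P: diff_perm_algebra "fscale :: 'k \<Rightarrow> ('x monomial \<Rightarrow>\<^sub>0 'k) \<Rightarrow> _" monomial_mul monomial_der
    by (rule diff_perm_algebra_monomial)
  note hom = hom_brace[where \<phi> = \<phi> and mul = mul, OF add mul]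
  show ?thesis
    using assms(4)
  proof (induction rule: normal_element.induct)
    case (brace f M z as y)
    then show ?case
      by (simp add: hom P.brace_circ gen o_def monomial_der_single monomial_der_funpow
          foldr_monomial_mul_letters monomial_mul_single del: brace.simps funpow.simps)
  qed (rule gen)
qed

text \<open>The composite \<open>\<phi>\<close> of \<open>\<rho>\<close> with the map to monomials
  has a left inverse sending a monomial to the normal element over it.\<close>

lemma sls_hom_permder_injective:
  fixes \<rho> :: "('x, 'k::field) free_sls \<Rightarrow> ('x, 'k) permder"
  assumes "algebra_hom sls_scale sls_mul permder_scale permder_circ \<rho>"
    and gen: "\<And>x. \<rho> (sls_gen x) = permder_gen x"
  shows "inj \<rho>"
proof -
  interpret S: sls_algebra "sls_scale :: 'k \<Rightarrow> ('x, 'k) free_sls \<Rightarrow> _" sls_mul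
    by (rule sls_algebra_free_sls)
  interpret \<rho>: Vector_Spaces.linear sls_scale permder_scale \<rho>
    using assms(1) by (simp add: algebra_hom_def)
  have \<rho>_mul: "\<rho> (sls_mul x y) = permder_mul (\<rho> x) (permder_der (\<rho> y))" for x y
    using assms(1) by (simp add: algebra_hom_def permder_circ_def)
  obtain \<theta> :: "('x, 'k) permder \<Rightarrow> 'x monomial \<Rightarrow>\<^sub>0 'k" where
    \<theta>: "algebra_hom permder_scale permder_mul fscale monomial_mul \<theta>"
      "\<And>a. \<theta> (permder_der a) = monomial_der (\<theta> a)"
      "\<And>x. \<theta> (permder_gen x) = Poly_Mapping.single ({#}, (x, 0)) 1"
    using ex1_implies_ex[OF permder_universal[OF diff_perm_algebra_monomial,
          of "\<lambda>x. Poly_Mapping.single ({#}, (x, 0)) 1"]] by blast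
  interpret \<theta>: Vector_Spaces.linear permder_scale fscale \<theta>
    using \<theta>(1) by (simp add: algebra_hom_def)
  define \<phi> where "\<phi> a = \<theta> (\<rho> a)" for a
  \<comment> \<open>If no normal element lies over \<open>m\<close>, the value \<open>h m\<close> is
    arbitrary; such \<open>m\<close> do not occur in the image of \<open>\<phi>\<close>.\<close>
  define h :: "'x monomial \<Rightarrow> ('x, 'k) free_sls" where
    "h m = (SOME f. normal_element sls_mul sls_gen f m)" for m
  let ?\<psi> = "lin_ext sls_scale h"
  interpret \<psi>: Vector_Spaces.linear fscale sls_scale ?\<psi>
    by (rule linear_lin_ext[OF S.vector_space_axioms])
  have \<psi>_normal: "?\<psi> (\<phi> f) = f" if f: "normal_element sls_mul sls_gen f m" for f m
  proof -
    have "\<phi> f = Poly_Mapping.single m 1"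
      using \<theta>(1) by (intro normal_element_hom_monomial[OF _ _ _ f])
        (simp_all add: \<phi>_def \<rho>.add \<theta>.add \<rho>_mul \<theta>(2,3) gen algebra_hom_def)
    moreover have "normal_element sls_mul sls_gen (h m) m"
      unfolding h_def using f by (rule someI)
    then have "h m = f" using f by (rule S.normal_element_unique)
    ultimately show ?thesis by (simp add: lin_ext_single[OF S.vector_space_axioms])
  qed
  have "?\<psi> (\<phi> a) = a" for a
  proof -
    let ?N = "normal_elements sls_mul (sls_gen :: 'x \<Rightarrow> ('x, 'k) free_sls)"
    have "a \<in> S.span ?N" by (simp add: span_normal_elements_sls)
    then show ?thesis
    proof (rule S.span_induct)
      show "S.subspace {a. ?\<psi> (\<phi> a) = a}"
        by (rule S.subspaceI)
           (simp_all add: \<phi>_def \<rho>.zero \<theta>.zero \<psi>.zero \<rho>.add \<theta>.add \<psi>.add \<rho>.scale \<theta>.scale \<psi>.scale)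
    qed (auto simp: normal_elements_def \<psi>_normal)
  qed
  then have "inj \<phi>" by (rule inj_on_inverseI)
  then show ?thesis unfolding \<phi>_def inj_def by metis
qed

text \<open>The preimage of a subalgebra that contains the images of the generators is the whole
  free SLS-algebra.\<close>

lemma sls_hom_range:
  fixes \<rho> :: "('x, 'k::field) free_sls \<Rightarrow> 'a::ab_group_add"
  assumes "nonassoc_algebra scale mul" and hom: "algebra_hom sls_scale sls_mul scale mul \<rho>"
  shows "range \<rho> = generated_subalgebra scale mul (range (\<lambda>x. \<rho> (sls_gen x)))"
proof -
  interpret A: nonassoc_algebra scale mul by fact
  interpret S: nonassoc_algebra "sls_scale :: 'k \<Rightarrow> ('x, 'k) free_sls \<Rightarrow> _" sls_mul
    by (rule nonassoc_algebra_sls)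
  interpret \<rho>: Vector_Spaces.linear sls_scale scale \<rho> using hom by (simp add: algebra_hom_def)
  have mul: "\<rho> (sls_mul x y) = mul (\<rho> x) (\<rho> y)" for x y
    using hom by (simp add: algebra_hom_def)
  have "subalgebra scale mul (range \<rho>)"
    unfolding subalgebra_def
    by (auto intro!: \<rho>.subspace_image S.subspace_UNIV simp flip: mul)
  moreover have "range \<rho> \<subseteq> T" if T: "subalgebra scale mul T" "range (\<lambda>x. \<rho> (sls_gen x)) \<subseteq> T" for T
  proof -
    have "{a. \<rho> a \<in> T} = UNIV"
      using T by (intro subalgebra_free_sls_UNIV)
        (auto simp: subalgebra_def mul \<rho>.zero \<rho>.add \<rho>.scale S.subspace_def A.subspace_def)
    then show ?thesis by auto
  qed
  ultimately show ?thesis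
    unfolding generated_subalgebra_def by (intro hull_unique[symmetric]) auto
qed

theorem theorem2:
  "algebra_isomorphic
     permder_scale permder_circ
       (generated_subalgebra permder_scale permder_circ
          (range (permder_gen :: 'x \<Rightarrow> ('x, 'k::field) permder)))
     sls_scale sls_mul (UNIV :: ('x, 'k) free_sls set)"
proof -
  interpret P: diff_perm_algebra
    "permder_scale :: 'k \<Rightarrow> ('x, 'k) permder \<Rightarrow> _" permder_mul permder_der
    by (rule diff_perm_algebra_permder)
  have circ: "permder_circ = (\<lambda>f h :: ('x, 'k) permder. permder_mul f (permder_der h))"
    by (simp add: fun_eq_iff permder_circ_def)
  obtain \<rho> :: "('x, 'k) free_sls \<Rightarrow> ('x, 'k) permder" where
    \<rho>: "algebra_hom sls_scale sls_mul permder_scale permder_circ \<rho>"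
      "\<And>x. \<rho> (sls_gen x) = permder_gen x"
    using ex1_implies_ex[OF free_sls_universal[OF P.sls_algebra_circ, of permder_gen]]
    unfolding circ by blast
  interpret \<rho>: Vector_Spaces.linear sls_scale permder_scale \<rho>
    using \<rho>(1) by (simp add: algebra_hom_def)
  have mul: "permder_circ (\<rho> x) (\<rho> y) = \<rho> (sls_mul x y)" for x y
    using \<rho>(1) by (simp add: algebra_hom_def)
  have inj: "inj \<rho>" using \<rho> by (rule sls_hom_permder_injective)
  have F: "generated_subalgebra permder_scale permder_circ (range permder_gen) = range \<rho>"
    using sls_hom_range[OF nonassoc_algebra_permder_circ \<rho>(1)] by (simp add: \<rho>(2))
  show ?thesis
    unfolding algebra_isomorphic_def F
  \<comment> \<open>The required map starts at the subalgebra, so it is the inverse of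
    \<open>\<rho>\<close>.\<close>
  proof (intro exI[of _ "inv \<rho>"] conjI ballI allI)
    show "bij_betw (inv \<rho>) (range \<rho>) UNIV"
      using inj by (intro bij_betw_inv_into inj_on_imp_bij_betw)
  qed (use inj in \<open>auto simp: mul simp flip: \<rho>.add \<rho>.scale\<close>)
qed

end
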